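(* Let $X_1,\ldots,X_d$ be independent random variables with laws $\mu(\mathfrak r_1),\ldots,\mu(\mathfrak r_d)$ belonging to the same Meixner class $\mathcal M(\mathfrak u)$. Write $\langle x\rangle=x_1+\cdots+x_d$ for any $d$-tuple $x$ (in particular $\langle\mathfrak r\rangle=\mathfrak r_1+\cdots+\mathfrak r_d$, $\langle X\rangle=X_1+\cdots+X_d$, $\langle n\rangle=n_1+\cdots+n_d$). Then for every $m\ge 0$ and $x\in\mathbb R^d$, $$P_m(\langle x\rangle;\langle\mathfrak r\rangle)=\sum_{\langle n\rangle=m}\binom{m}{n}\prod_{i=1}^dP_{n_i}(x_i;\mathfrak r_i),$$ and for every $n=(n_1,\ldots,n_d)$ with $n_i\ge 0$ integers, $$\mathbb E\Big[\prod_{i=1}^dP_{n_i}(X_i;\mathfrak r_i)\,\Big|\,\langle X\rangle\Big]=\binom{\langle n\rangle}{n}\frac{\prod_{i=1}^d\mathfrak h_{n_i}(\mathfrak r_i)}{\mathfrak h_{\langle n\rangle}(\langle\mathfrak r\rangle)}P_{\langle n\rangle}(\langle X\rangle;\langle\mathfrak r\rangle)\quad\text{a.s.},$$ where $\binom{\langle n\rangle}{n}=\langle n\rangle!/(n_1!\cdots n_d!)$ is the multinomial coefficient.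
   Context: Meixner classes. Let $\mathfrak u$ be a real function with a power series expansion near $0$, $\mathfrak u(0)=0$, $\mathfrak u'(0)=1$. The Meixner class $\mathcal M(\mathfrak u)$ is the set of probability laws $\mu$ on $\mathbb R$ with positive variance, whose moment generating function $M(t)=\int e^{tx}\mu(dx)$ is finite in an open interval containing $0$, and such that the polynomials $P_n$ (monic of degree $n$) defined by $\frac{e^{x\mathfrak u(z)}}{M(\mathfrak u(z))}=\sum_{n\ge0}P_n(x)\frac{z^n}{n!}$ for $z$ near $0$ are orthogonal: $\int P_mP_n\,d\mu=0$ for $m\ne n$. With $\mathfrak v$ the inverse of $\mathfrak u$ near $0$, one has $M'(t)/M(t)=\mathfrak s^2\mathfrak v(t)+\mathfrak m$, where $\mathfrak m,\mathfrak s^2$ are the mean and variance of $\mu$; hence a law in $\mathcal M(\mathfrak u)$ is determined by $\mathfrak r=(\mathfrak m,\mathfrak s^2)$ and is denoted $\mu(\mathfrak r)$; its polynomials are $P_n(\cdot;\mathfrak r)$ and $\mathfrak h_n(\mathfrak r)=\int P_n(x;\mathfrak r)^2\mu(\mathfrak r)(dx)$. It is known that $(P_n(\cdot;\mathfrak r))_n$ is a complete orthogonal system in $L^2(\mu(\mathfrak r))$, and that if $\mu(\mathfrak r_1),\mu(\mathfrak r_2)\in\mathcal M(\mathfrak u)$ then $\mu(\mathfrak r_1)*\mu(\mathfrak r_2)=\mu(\mathfrak r_1+\mathfrak r_2)\in\mathcal M(\mathfrak u)$. Convention: when $\mathfrak h_{\langle n\rangle}(\langle\mathfrak r\rangle)=0$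 (only possible for finitely supported laws; the numerator then also vanishes) the quotient is read as $0$. *)

theory Defs
  imports "HOL-Probability.Probability"
begin

definition mgf :: "real measure \<Rightarrow> real \<Rightarrow> real" where
  "mgf \<mu> t = (\<integral>x. exp (t * x) \<partial>\<mu>)"

definition law_mean :: "real measure \<Rightarrow> real" where
  "law_mean \<mu> = (\<integral>x. x \<partial>\<mu>)"

definition law_variance :: "real measure \<Rightarrow> real" where
  "law_variance \<mu> = (\<integral>x. (x - law_mean \<mu>)\<^sup>2 \<partial>\<mu>)"

(* exp (x * u z) / M (u z) = (\<Sum>n. P n x * z ^ n / n!) for z near 0, as a convergent power
   series; P is uniquely determined by this. *)
definition meixner_polys :: "(real \<Rightarrow> real) \<Rightarrow> real measure \<Rightarrow> (nat \<Rightarrow> real poly) \<Rightarrow> bool" where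
  "meixner_polys u \<mu> P \<longleftrightarrow>
     (\<forall>n. degree (P n) = n \<and> lead_coeff (P n) = 1) \<and>
     (\<forall>x. (\<lambda>z. exp (x * u z) / mgf \<mu> (u z)) has_fps_expansion
            Abs_fps (\<lambda>n. poly (P n) x / fact n))"

definition meixner_class :: "(real \<Rightarrow> real) \<Rightarrow> real measure set" where
  "meixner_class u = {\<mu>. real_distribution \<mu> \<and> law_variance \<mu> > 0 \<and>
     (\<exists>a b. a < 0 \<and> 0 < b \<and> (\<forall>t\<in>{a<..<b}. integrable \<mu> (\<lambda>x. exp (t * x)))) \<and>
     (\<exists>P. meixner_polys u \<mu> P \<and>
        (\<forall>m n. m \<noteq> n \<longrightarrow> (\<integral>x. poly (P m) x * poly (P n) x \<partial>\<mu>) = 0))}"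

(* A law in the class is determined by its mean and variance r = (m, s^2), so for such r
   the description below denotes the law of the class with these parameters. *)
definition meixner_law :: "(real \<Rightarrow> real) \<Rightarrow> real \<times> real \<Rightarrow> real measure" where
  "meixner_law u r = (THE \<mu>. \<mu> \<in> meixner_class u \<and> (law_mean \<mu>, law_variance \<mu>) = r)"

definition meixner_poly :: "(real \<Rightarrow> real) \<Rightarrow> real \<times> real \<Rightarrow> nat \<Rightarrow> real poly" where
  "meixner_poly u r = (THE P. meixner_polys u (meixner_law u r) P)"

definition meixner_norm2 :: "(real \<Rightarrow> real) \<Rightarrow> real \<times> real \<Rightarrow> nat \<Rightarrow> real" where
  "meixner_norm2 u r n = (\<integral>x. (poly (meixner_poly u r n) x)\<^sup>2 \<partial>(meixner_law u r))"

definition multinomial_coeff :: "nat \<Rightarrow> (nat \<Rightarrow> nat) \<Rightarrow> real" where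
  "multinomial_coeff d n = fact (\<Sum>i=1..d. n i) / (\<Prod>i=1..d. fact (n i))"

end

theory Submission
  imports Defs "HOL-Complex_Analysis.Laurent_Convergence"
begin

text \<open>
  Let \<open>U\<close> be the power series of \<open>u\<close>, write \<open>m(z)\<close> for the power series of the moment generating
  function of a law of the class, and let \<open>P n\<close> be its polynomials and \<open>h n\<close> their squared norms.
  Integrating \<open>P n\<close> against \<open>exp (x * U z) = m (U z) * (\<Sum>k. P k x * z ^ k / k!)\<close> and using
  orthogonality gives \<open>\<integral>x. P n x * exp (x * U z) = m (U z) * h n * z ^ n / n!\<close> as formal power series.

  For \<open>n = 1\<close> this is the differential equation \<open>m' (U z) = (mean + variance * z) * m (U z)\<close>. As \<open>U\<close>
  is invertible under composition, it determines \<open>m\<close> and, because exponential moments exist, the law.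

  The generating functions of independent laws multiply. Hence the polynomials of the sum \<open>S\<close> are given
  by the multinomial formula, which in turn shows that they are orthogonal. Applied to the summands and
  to \<open>S\<close>, the displayed identity shows that the product of the \<open>P (n i) (X i)\<close> and the claimed multiple
  of \<open>Q m S\<close> have the same expectation against \<open>exp (t * S)\<close> for \<open>t\<close> near \<open>0\<close>, hence against \<open>S ^ k\<close> for
  every \<open>k\<close>. Exponential moments then give equality of their integrals over every event \<open>S \<in> A\<close>.
\<close>

subsection \<open>Exponential moments\<close>

lemma exp_ge_power_term:
  fixes x :: real
  assumes "x \<ge> 0"
  shows "x ^ k /\<^sub>R fact k \<le> exp x"
  using sum_le_suminf[OF summable_exp_generic[of x], of "{k}"] assms
  by (simp add: exp_def)

text \<open>The partial sums of the exponential series are dominated by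
  \<open>exp (norm t * \<bar>S x\<bar>)\<close>, so dominated convergence permits termwise
  integration. A normed field as codomain covers real moment series as well as Fourier integrals,
  where \<open>t\<close> is imaginary.\<close>

lemma exp_integral_sums:
  fixes Y :: "'a \<Rightarrow> 'b::{real_normed_field,banach,second_countable_topology}" and S :: "'a \<Rightarrow> real"
  assumes [measurable]: "Y \<in> borel_measurable M" "S \<in> borel_measurable M"
    and int: "integrable M (\<lambda>x. norm (Y x) * exp (norm t * \<bar>S x\<bar>))"
  shows "(\<lambda>k. t ^ k / fact k * (\<integral>x. Y x * of_real (S x) ^ k \<partial>M)) sums
           (\<integral>x. Y x * exp (t * of_real (S x)) \<partial>M)"
proof -
  define c where "c k x = Y x * ((t * of_real (S x)) ^ k /\<^sub>R fact k)" for k x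
  have exp_sums: "(\<lambda>k. (t * of_real (S x)) ^ k /\<^sub>R fact k) sums exp (t * of_real (S x))" for x
    by (rule exp_converges)
  have bound: "norm (\<Sum>k<n. c k x) \<le> norm (Y x) * exp (norm t * \<bar>S x\<bar>)" for n x
  proof -
    have "norm (\<Sum>k<n. c k x) \<le> (\<Sum>k<n. norm (c k x))"
      by (rule norm_sum)
    also have "\<dots> = norm (Y x) * (\<Sum>k<n. (norm t * \<bar>S x\<bar>) ^ k /\<^sub>R fact k)"
      by (simp add: c_def norm_mult norm_power norm_divide sum_distrib_left mult_ac)
    also have "\<dots> \<le> norm (Y x) * exp (norm t * \<bar>S x\<bar>)"
      unfolding exp_def
      by (intro mult_left_mono sum_le_suminf summable_exp_generic) auto
    finally show ?thesis .
  qed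
  have meas [measurable]: "c k \<in> borel_measurable M" for k
    unfolding c_def by measurable
  have c_int: "integrable M (c k)" for k
  proof (rule Bochner_Integration.integrable_bound[OF int])
    show "AE x in M. norm (c k x) \<le> norm (norm (Y x) * exp (norm t * \<bar>S x\<bar>))"
    proof (intro always_eventually allI)
      fix x
      have "(norm t * \<bar>S x\<bar>) ^ k /\<^sub>R fact k \<le> exp (norm t * \<bar>S x\<bar>)"
        by (rule exp_ge_power_term) simp
      from mult_left_mono[OF this, of "norm (Y x)"]
      show "norm (c k x) \<le> norm (norm (Y x) * exp (norm t * \<bar>S x\<bar>))"
        by (simp add: c_def norm_mult norm_power norm_divide mult_ac)
    qed
  qed measurable
  have "(\<lambda>n. \<integral>x. (\<Sum>k<n. c k x) \<partial>M) \<longlonglongrightarrow> (\<integral>x. Y x * exp (t * of_real (S x)) \<partial>M)"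
  proof (rule integral_dominated_convergence[OF _ _ int])
    show "AE x in M. (\<lambda>n. \<Sum>k<n. c k x) \<longlonglongrightarrow> Y x * exp (t * of_real (S x))"
      using sums_mult[OF exp_sums] by (auto simp: sums_def c_def)
  qed (use bound in auto)
  moreover have "(\<integral>x. (\<Sum>k<n. c k x) \<partial>M) =
      (\<Sum>k<n. t ^ k / fact k * (\<integral>x. Y x * of_real (S x) ^ k \<partial>M))" for n
  proof -
    have "(\<integral>x. c k x \<partial>M) = t ^ k / fact k * (\<integral>x. Y x * of_real (S x) ^ k \<partial>M)" for k
    proof -
      have "c k = (\<lambda>x. t ^ k / fact k * (Y x * of_real (S x) ^ k))"
        by (simp add: c_def fun_eq_iff power_mult_distrib scaleR_conv_of_real divide_inverse mult_ac)
      thus ?thesis by simp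
    qed
    thus ?thesis by (simp add: Bochner_Integration.integral_sum c_int)
  qed
  ultimately show ?thesis by (simp add: sums_def)
qed

lemma power_le_exp:
  fixes x :: real
  assumes "\<epsilon> > 0"
  shows "\<bar>x\<bar> ^ k \<le> fact k / \<epsilon> ^ k * exp (\<epsilon> * \<bar>x\<bar>)"
proof -
  have "(\<epsilon> * \<bar>x\<bar>) ^ k /\<^sub>R fact k \<le> exp (\<epsilon> * \<bar>x\<bar>)"
    by (rule exp_ge_power_term) (use assms in simp)
  hence "\<epsilon> ^ k * \<bar>x\<bar> ^ k \<le> exp (\<epsilon> * \<bar>x\<bar>) * fact k"
    by (simp add: divide_inverse_commute[symmetric] divide_le_eq power_mult_distrib)
  thus ?thesis using assms by (simp add: le_divide_eq mult_ac)
qed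

text \<open>A power of \<open>\<bar>S x\<bar>\<close> costs only the spare rate
  \<open>\<delta> - \<epsilon>\<close> of the exponential. With \<open>\<epsilon> = 0\<close> this
  yields ordinary moments.\<close>

lemma integrable_power_exp:
  fixes S :: "'a \<Rightarrow> real" and Y :: "'a \<Rightarrow> 'b::{banach,second_countable_topology,real_normed_algebra_1}"
  assumes [measurable]: "Y \<in> borel_measurable M" "S \<in> borel_measurable M"
    and int: "integrable M (\<lambda>x. norm (Y x) * exp (\<delta> * \<bar>S x\<bar>))" and "\<epsilon> < \<delta>"
  shows "integrable M (\<lambda>x. norm (Y x) * \<bar>S x\<bar> ^ k * exp (\<epsilon> * \<bar>S x\<bar>))"
proof (rule Bochner_Integration.integrable_bound)
  show "integrable M (\<lambda>x. fact k / (\<delta> - \<epsilon>) ^ k * (norm (Y x) * exp (\<delta> * \<bar>S x\<bar>)))"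
    using int by simp
  show "AE x in M. norm (norm (Y x) * \<bar>S x\<bar> ^ k * exp (\<epsilon> * \<bar>S x\<bar>)) \<le>
          norm (fact k / (\<delta> - \<epsilon>) ^ k * (norm (Y x) * exp (\<delta> * \<bar>S x\<bar>)))"
  proof (intro always_eventually allI)
    fix x
    have "norm (norm (Y x) * \<bar>S x\<bar> ^ k * exp (\<epsilon> * \<bar>S x\<bar>)) =
        norm (Y x) * \<bar>S x\<bar> ^ k * exp (\<epsilon> * \<bar>S x\<bar>)"
      by simp
    also have "\<dots> \<le> norm (Y x) * (fact k / (\<delta> - \<epsilon>) ^ k * exp ((\<delta> - \<epsilon>) * \<bar>S x\<bar>)) * exp (\<epsilon> * \<bar>S x\<bar>)"
      using \<open>\<epsilon> < \<delta>\<close> by (intro mult_right_mono mult_left_mono power_le_exp) auto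
    also have "\<dots> = fact k / (\<delta> - \<epsilon>) ^ k * (norm (Y x) * exp (\<delta> * \<bar>S x\<bar>))"
      by (simp add: algebra_simps exp_diff)
    finally show "norm (norm (Y x) * \<bar>S x\<bar> ^ k * exp (\<epsilon> * \<bar>S x\<bar>)) \<le>
          norm (fact k / (\<delta> - \<epsilon>) ^ k * (norm (Y x) * exp (\<delta> * \<bar>S x\<bar>)))"
      using \<open>\<epsilon> < \<delta>\<close> by (simp add: abs_mult)
  qed
qed measurable

text \<open>The characteristic function has a power series of radius at least \<open>\<delta>\<close> about every real point,
  so equality of all its derivatives propagates from \<open>0\<close> in steps shorter than \<open>\<delta>\<close>.\<close>

lemma real_distribution_eq_if_moments_eq:
  assumes "real_distribution \<mu>" "real_distribution \<nu>" and "\<delta> > 0"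
    and int_\<mu>: "integrable \<mu> (\<lambda>x. exp (\<delta> * \<bar>x\<bar>))" and int_\<nu>: "integrable \<nu> (\<lambda>x. exp (\<delta> * \<bar>x\<bar>))"
    and moments: "\<And>k. (\<integral>x. x ^ k \<partial>\<mu>) = (\<integral>x. x ^ k \<partial>\<nu>)"
  shows "\<mu> = \<nu>"
proof -
  interpret \<mu>: real_distribution \<mu> by fact
  interpret \<nu>: real_distribution \<nu> by fact
  \<comment> \<open>Up to the factor \<open>\<i> ^ k\<close>, this is the \<open>k\<close>-th
    derivative of the characteristic function at \<open>s\<close>; \<open>shift\<close> is its
    Taylor expansion about \<open>s\<close>.\<close>
  define C where "C \<rho> k s = (\<integral>x. of_real x ^ k * iexp (s * x) \<partial>\<rho>)" for \<rho> k s
  have shift: "(\<lambda>j. (\<i> * h) ^ j / fact j * C \<rho> (k + j) s) sums C \<rho> k (s + h)"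
    if "real_distribution \<rho>" "integrable \<rho> (\<lambda>x. exp (\<delta> * \<bar>x\<bar>))" "\<bar>h\<bar> < \<delta>" for \<rho> k s and h :: real
  proof -
    interpret \<rho>: real_distribution \<rho> by fact
    have "integrable \<rho> (\<lambda>x. norm (1::real) * \<bar>x\<bar> ^ k * exp (\<bar>h\<bar> * \<bar>x\<bar>))"
      by (rule integrable_power_exp) (use that in auto)
    hence *: "integrable \<rho> (\<lambda>x. norm (of_real x ^ k * iexp (s * x)) * exp (norm (\<i> * h) * \<bar>x\<bar>))"
      by (simp add: norm_mult norm_power)
    have "(\<lambda>j. (\<i> * h) ^ j / fact j * (\<integral>x. (of_real x ^ k * iexp (s * x)) * of_real x ^ j \<partial>\<rho>)) sums
            (\<integral>x. (of_real x ^ k * iexp (s * x)) * exp (\<i> * h * of_real x) \<partial>\<rho>)"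
      by (rule exp_integral_sums[OF _ _ *]) auto
    moreover have "of_real x ^ k * iexp (s * x) * of_real x ^ j = of_real x ^ (k + j) * iexp (s * x)" for x :: real and j
      by (simp add: power_add mult_ac)
    moreover have "of_real x ^ k * iexp (s * x) * exp (\<i> * h * of_real x) = of_real x ^ k * iexp ((s + h) * x)" for x :: real
      by (simp add: exp_add[symmetric] distrib_left distrib_right mult_ac add_ac)
    ultimately show ?thesis
      unfolding C_def by (simp only:)
  qed
  have step: "\<forall>k. C \<mu> k (s + h) = C \<nu> k (s + h)" if "\<forall>k. C \<mu> k s = C \<nu> k s" "\<bar>h\<bar> < \<delta>" for s h
  proof
    fix k
    have "(\<lambda>j. (\<i> * h) ^ j / fact j * C \<nu> (k + j) s) sums C \<mu> k (s + h)"
      using shift[OF assms(1) int_\<mu> that(2), of k s] that(1) by simp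
    thus "C \<mu> k (s + h) = C \<nu> k (s + h)"
      using shift[OF assms(2) int_\<nu> that(2), of k s] by (rule sums_unique2)
  qed
  have zero: "C \<mu> k 0 = C \<nu> k 0" for k
  proof -
    have "C \<rho> k 0 = of_real (\<integral>x. x ^ k \<partial>\<rho>)" for \<rho>
    proof -
      have "C \<rho> k 0 = (\<integral>x. complex_of_real (x ^ k) \<partial>\<rho>)"
        by (simp add: C_def)
      thus ?thesis by (simp only: integral_complex_of_real)
    qed
    thus ?thesis using moments[of k] by simp
  qed
  have multiples: "\<forall>k. C \<mu> k (real n * h) = C \<nu> k (real n * h)" if "\<bar>h\<bar> < \<delta>" for n h
  proof (induction n)
    case (Suc n)
    have "real (Suc n) * h = real n * h + h" by (simp add: algebra_simps)
    with step[OF Suc that] show ?case by simp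
  qed (use zero in auto)
  have "char \<mu> s = char \<nu> s" for s
  proof -
    \<comment> \<open>Then \<open>n\<close> steps of length
      \<open>\<bar>s\<bar> / n < \<delta>\<close> lead from 0 to \<open>s\<close>.\<close>
    obtain n :: nat where n: "\<bar>s\<bar> / \<delta> < real n" using reals_Archimedean2 by blast
    hence "n > 0" using \<open>\<delta> > 0\<close> by (smt (verit) divide_nonneg_pos of_nat_0_less_iff)
    hence "\<bar>s / n\<bar> < \<delta>" using n \<open>\<delta> > 0\<close> by (simp add: field_simps)
    from multiples[OF this, of n] \<open>n > 0\<close> have "C \<mu> 0 s = C \<nu> 0 s" by simp
    thus ?thesis by (simp add: C_def char_def)
  qed
  thus ?thesis using Levy_uniqueness[OF assms(1,2)] by blast
qed


text \<open>The positive and negative parts of \<open>Y\<close>, taken as densities and pushed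
  forward along \<open>S\<close>, give two finite measures with the same moments. After
  normalisation they are laws with exponential moments, so they coincide, and the integral is a
  multiple of the difference of their values at \<open>A\<close>.\<close>

lemma integral_vimage_eq_0_if_moments_eq_0:
  fixes Y S :: "'a \<Rightarrow> real"
  assumes [measurable]: "Y \<in> borel_measurable M" "S \<in> borel_measurable M"
    and "\<delta> > 0" and int: "integrable M (\<lambda>x. \<bar>Y x\<bar> * exp (\<delta> * \<bar>S x\<bar>))"
    and moments: "\<And>k. (\<integral>x. Y x * S x ^ k \<partial>M) = 0"
    and [measurable]: "A \<in> sets borel"
  shows "(\<integral>x. Y x * indicator A (S x) \<partial>M) = 0"
proof -
  have int_moment: "integrable M (\<lambda>x. g x * S x ^ k)"
    if [measurable]: "g \<in> borel_measurable M" and "\<And>x. \<bar>g x\<bar> \<le> \<bar>Y x\<bar>" for g k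
  proof (rule Bochner_Integration.integrable_bound)
    show "integrable M (\<lambda>x. norm (Y x) * \<bar>S x\<bar> ^ k * exp (0 * \<bar>S x\<bar>))"
      by (rule integrable_power_exp[where \<delta> = \<delta>]) (use int \<open>\<delta> > 0\<close> in auto)
    show "AE x in M. norm (g x * S x ^ k) \<le> norm (norm (Y x) * \<bar>S x\<bar> ^ k * exp (0 * \<bar>S x\<bar>))"
      using that(2) by (auto simp: abs_mult power_abs intro!: mult_right_mono)
  qed measurable
  \<comment> \<open>Since the zeroth moment is 0, the positive and negative parts of
    \<open>Y\<close> both have integral \<open>c\<close>; hence \<open>c = 0\<close> means that
    \<open>Y\<close> vanishes almost everywhere.\<close>
  define c where "c = (\<integral>x. \<bar>Y x\<bar> \<partial>M) / 2"
  have int_abs: "integrable M (\<lambda>x. \<bar>Y x\<bar>)" and int_Y: "integrable M Y"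
    using int_moment[of "\<lambda>x. \<bar>Y x\<bar>" 0] int_moment[of Y 0] by simp_all
  show ?thesis
  proof (cases "c = 0")
    case True
    hence "(\<integral>x. \<bar>Y x\<bar> \<partial>M) = 0" by (simp add: c_def)
    hence "AE x in M. \<bar>Y x\<bar> = 0"
      by (subst (asm) integral_nonneg_eq_0_iff_AE[OF int_abs]) auto
    hence "(\<integral>x. Y x * indicator A (S x) \<partial>M) = (\<integral>x. 0 \<partial>M)"
      by (intro integral_cong_AE) auto
    thus ?thesis by simp
  next
    case False
    hence "c > 0" by (simp add: c_def less_le)
    \<comment> \<open>\<open>g 1\<close> and \<open>g (-1)\<close> are the positive and negative parts of \<open>Y\<close>, divided by their common mass \<open>c\<close>.\<close>
    define g :: "real \<Rightarrow> 'a \<Rightarrow> real" where "g \<sigma> x = (\<bar>Y x\<bar> + \<sigma> * Y x) / (2 * c)" for \<sigma> x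
    have [measurable]: "g \<sigma> \<in> borel_measurable M" for \<sigma>
      unfolding g_def by measurable
    define \<nu> where "\<nu> \<sigma> = distr (density M (\<lambda>x. ennreal (g \<sigma> x))) borel S" for \<sigma>
    have g_nonneg: "g \<sigma> x \<ge> 0" if "\<bar>\<sigma>\<bar> = 1" for \<sigma> x
      unfolding g_def using \<open>c > 0\<close> that by (intro divide_nonneg_pos) (auto simp: abs_if split: if_splits)
    have int_g: "integrable M (g \<sigma>)" for \<sigma>
      unfolding g_def using int_abs int_Y by auto
    have int_\<nu>: "(\<integral>x. f x \<partial>\<nu> \<sigma>) = (\<integral>x. g \<sigma> x * f (S x) \<partial>M)"
      if [measurable]: "f \<in> borel_measurable borel" and "\<bar>\<sigma>\<bar> = 1" for \<sigma> and f :: "real \<Rightarrow> real"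
      unfolding \<nu>_def using g_nonneg[OF that(2)] by (simp add: integral_distr integral_density)
    have g_int: "(\<integral>x. g \<sigma> x * f (S x) \<partial>M) =
        ((\<integral>x. \<bar>Y x\<bar> * f (S x) \<partial>M) + \<sigma> * (\<integral>x. Y x * f (S x) \<partial>M)) / (2 * c)"
      if "integrable M (\<lambda>x. \<bar>Y x\<bar> * f (S x))" "integrable M (\<lambda>x. Y x * f (S x))" for f \<sigma>
    proof -
      have "(\<lambda>x. g \<sigma> x * f (S x)) = (\<lambda>x. (\<bar>Y x\<bar> * f (S x) + \<sigma> * (Y x * f (S x))) / (2 * c))"
        by (simp add: g_def fun_eq_iff algebra_simps)
      thus ?thesis using that by simp
    qed
    have distribution: "real_distribution (\<nu> \<sigma>)" if "\<bar>\<sigma>\<bar> = 1" for \<sigma>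
    proof -
      have "(\<integral>x. g \<sigma> x \<partial>M) = 1"
        using g_int[of "\<lambda>_. 1" \<sigma>] int_abs int_Y moments[of 0] \<open>c > 0\<close> by (simp add: c_def)
      hence "emeasure (density M (\<lambda>x. ennreal (g \<sigma> x))) (space M) = 1"
        using int_g[of \<sigma>] g_nonneg[OF that]
        by (simp add: emeasure_density nn_integral_eq_integral cong: nn_integral_cong)
      hence "prob_space (density M (\<lambda>x. ennreal (g \<sigma> x)))"
        by (intro prob_spaceI) simp
      thus ?thesis
        unfolding \<nu>_def by (simp add: prob_space.real_distribution_distr)
    qed
    have exp_int: "integrable (\<nu> \<sigma>) (\<lambda>x. exp (\<delta> * \<bar>x\<bar>))" if "\<bar>\<sigma>\<bar> = 1" for \<sigma>
    proof -
      have "integrable M (\<lambda>x. g \<sigma> x * exp (\<delta> * \<bar>S x\<bar>))"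
      proof (rule Bochner_Integration.integrable_bound)
        show "integrable M (\<lambda>x. 1 / c * (\<bar>Y x\<bar> * exp (\<delta> * \<bar>S x\<bar>)))"
          using int by simp
        have "g \<sigma> x \<le> 1 / c * \<bar>Y x\<bar>" for x
          using \<open>c > 0\<close> that by (auto simp: g_def field_simps abs_if split: if_splits)
        hence "g \<sigma> x * exp (\<delta> * \<bar>S x\<bar>) \<le> 1 / c * \<bar>Y x\<bar> * exp (\<delta> * \<bar>S x\<bar>)" for x
          by (intro mult_right_mono) auto
        thus "AE x in M. norm (g \<sigma> x * exp (\<delta> * \<bar>S x\<bar>)) \<le> norm (1 / c * (\<bar>Y x\<bar> * exp (\<delta> * \<bar>S x\<bar>)))"
          using g_nonneg[OF that] \<open>c > 0\<close> by (simp add: abs_mult)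
      qed measurable
      thus ?thesis
        unfolding \<nu>_def using g_nonneg[OF that] by (simp add: integrable_distr_eq integrable_density)
    qed
    have "\<nu> 1 = \<nu> (-1)"
    proof (rule real_distribution_eq_if_moments_eq[OF distribution distribution \<open>\<delta> > 0\<close> exp_int exp_int])
      fix k
      show "(\<integral>x. x ^ k \<partial>\<nu> 1) = (\<integral>x. x ^ k \<partial>\<nu> (-1))"
        using g_int[of "\<lambda>x. x ^ k"] int_moment[of "\<lambda>x. \<bar>Y x\<bar>" k] int_moment[of Y k] moments[of k]
        by (simp add: int_\<nu>)
    qed auto
    hence "(\<integral>x. g 1 x * indicator A (S x) \<partial>M) = (\<integral>x. g (-1) x * indicator A (S x) \<partial>M)"
      using int_\<nu>[of "indicator A" 1] int_\<nu>[of "indicator A" "-1"] by (simp del: integral_indicator)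
    moreover have "integrable M (\<lambda>x. \<bar>Y x\<bar> * indicator A (S x))" "integrable M (\<lambda>x. Y x * indicator A (S x))"
      by (rule Bochner_Integration.integrable_bound[OF int_Y]; simp add: indicator_def)+
    ultimately show ?thesis
      using g_int[of "indicator A" 1] g_int[of "indicator A" "-1"] \<open>c > 0\<close>
      by simp
  qed
qed


subsection \<open>Real power series expansions\<close>

text \<open>Zeros of a nonzero power series are isolated, whereas the difference of two expansions
  of one function evaluates to 0 on a whole neighbourhood of 0.\<close>

lemma fps_expansion_unique:
  fixes f :: "'a::{banach,real_normed_field} \<Rightarrow> 'a"
  assumes F: "f has_fps_expansion F" and G: "f has_fps_expansion G"
  shows "F = G"
proof (rule ccontr)
  assume "F \<noteq> G"
  define H where "H = F - G"
  have "(\<lambda>x. f x - f x) has_fps_expansion H"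
    unfolding H_def by (intro fps_expansion_intros F G)
  hence H: "fps_conv_radius H > 0" "\<forall>\<^sub>F z in nhds 0. eval_fps H z = 0"
    by (auto simp: has_fps_expansion_def)
  from \<open>F \<noteq> G\<close> obtain m where m: "fps_nth H m \<noteq> 0"
    by (auto simp: H_def fps_eq_iff)
  have H0: "eval_fps H 0 = 0"
    using H(2) eventually_nhds_x_imp_x by blast
  \<comment> \<open>\<open>powser_0_nonzero\<close> wants a nonzero coefficient of positive index;
    the value at 0 excludes index 0.\<close>
  hence "m > 0"
    using m by (auto simp: eval_fps_at_0 intro!: Nat.gr0I)
  obtain r where r: "r > 0" "ereal r < fps_conv_radius H"
    using ereal_dense2[OF H(1)] by (auto simp: zero_ereal_def)
  obtain s where s: "s > 0" "\<And>z. z \<in> cball 0 s - {0} \<Longrightarrow> eval_fps H z \<noteq> 0"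
  proof (rule powser_0_nonzero[of r 0 "fps_nth H" "eval_fps H"])
    fix x :: 'a assume "norm (x - 0) < r"
    hence "ereal (norm x) < fps_conv_radius H"
      using r(2) by (metis diff_zero ereal_less_eq(3) less_imp_le order.strict_trans1)
    thus "(\<lambda>n. fps_nth H n * (x - 0) ^ n) sums eval_fps H x"
      using sums_eval_fps by simp
  qed (use r m \<open>m > 0\<close> H0 in auto)
  from H(2) obtain e where e: "e > 0" "\<And>z. norm z < e \<Longrightarrow> eval_fps H z = 0"
    unfolding eventually_nhds_metric by auto
  \<comment> \<open>A positive real multiple of 1 inside both balls, available in every real normed
    field.\<close>
  define z :: 'a where "z = of_real (min s (e / 2))"
  have "z \<in> cball 0 s - {0}" "norm z < e"
    using \<open>s > 0\<close> \<open>e > 0\<close> by (auto simp: z_def)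
  with s(2) e(2) show False by blast
qed

section \<open>Composition of real power series through complexification\<close>

definition complex_fps :: "real fps \<Rightarrow> complex fps" where
  "complex_fps F = Abs_fps (\<lambda>n. of_real (fps_nth F n))"

lemma complex_fps_nth [simp]: "fps_nth (complex_fps F) n = of_real (fps_nth F n)"
  by (simp add: complex_fps_def)

lemma complex_fps_mult: "complex_fps (F * G) = complex_fps F * complex_fps G"
  by (simp add: fps_eq_iff fps_mult_nth)

lemma complex_fps_power: "complex_fps (F ^ k) = complex_fps F ^ k"
  by (induction k) (simp_all add: complex_fps_mult, simp add: fps_eq_iff)

lemma complex_fps_compose: "complex_fps (F oo G) = complex_fps F oo complex_fps G"
  by (simp add: fps_eq_iff fps_compose_nth complex_fps_power[symmetric])

lemma fps_conv_radius_complex_fps [simp]: "fps_conv_radius (complex_fps F) = fps_conv_radius F"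
proof -
  have "fps_conv_radius (complex_fps F) = conv_radius (\<lambda>n. norm (complex_of_real (fps_nth F n)))"
    unfolding fps_conv_radius_def by (subst conv_radius_norm) simp
  also have "\<dots> = conv_radius (\<lambda>n. norm (fps_nth F n))"
    by simp
  also have "\<dots> = fps_conv_radius F"
    unfolding fps_conv_radius_def by (rule conv_radius_norm)
  finally show ?thesis .
qed

lemma eval_fps_complex_fps:
  fixes F :: "real fps"
  assumes "ereal \<bar>x\<bar> < fps_conv_radius F"
  shows "eval_fps (complex_fps F) (of_real x) = of_real (eval_fps F x)"
proof -
  have "(\<lambda>n. of_real (fps_nth F n * x ^ n)) sums complex_of_real (eval_fps F x)"
    using sums_of_real[OF sums_eval_fps[of x F]] assms by simp
  thus ?thesis
    unfolding eval_fps_def by (simp add: sums_iff)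
qed

lemma eventually_eval_fps_complex_fps:
  assumes "fps_conv_radius F > 0"
  shows "\<forall>\<^sub>F x in nhds 0. eval_fps (complex_fps F) (of_real x) = of_real (eval_fps F x)"
proof -
  obtain r where r: "r > 0" "ereal r < fps_conv_radius F"
    using ereal_dense2[OF assms] by (auto simp: zero_ereal_def)
  have "\<forall>\<^sub>F x in nhds 0. \<bar>x\<bar> < r"
    using r(1) by (auto simp: eventually_nhds_metric dist_norm)
  thus ?thesis
  proof eventually_elim
    case (elim x)
    hence "ereal \<bar>x\<bar> < fps_conv_radius F"
      using r(2) by (metis ereal_less_eq(3) less_imp_le order.strict_trans1)
    thus ?case by (rule eval_fps_complex_fps)
  qed
qed

text \<open>Composition is carried out for the complexified series and read back on the real axis,
  where near 0 the complex evaluations are the embedded real ones.\<close>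

lemma has_fps_expansion_compose_real:
  fixes f g :: "real \<Rightarrow> real"
  assumes F: "f has_fps_expansion F" and G: "g has_fps_expansion G" and G0: "fps_nth G 0 = 0"
  shows "(\<lambda>x. f (g x)) has_fps_expansion (F oo G)"
proof -
  let ?F = "complex_fps F" and ?G = "complex_fps G"
  have radius: "fps_conv_radius F > 0" "fps_conv_radius G > 0"
    using F G by (auto simp: has_fps_expansion_def)
  have "(eval_fps ?F \<circ> eval_fps ?G) has_fps_expansion (?F oo ?G)"
    using radius G0 by (intro has_fps_expansion_compose eval_fps_has_fps_expansion) auto
  hence FG: "fps_conv_radius (F oo G) > 0"
      "\<forall>\<^sub>F z in nhds 0. eval_fps (complex_fps (F oo G)) z = eval_fps ?F (eval_fps ?G z)"
    by (simp_all add: has_fps_expansion_def complex_fps_compose[symmetric])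
  have lim: "filterlim complex_of_real (nhds 0) (nhds 0)"
    using tendsto_of_real[OF filterlim_ident, of "0::real", where 'a = complex] by simp
  have "continuous (at 0) g"
    using has_fps_expansion_imp_continuous[OF G, of UNIV] by simp
  moreover have "g 0 = 0"
    using has_fps_expansion_imp_0_eq_fps_nth_0[OF G] G0 by simp
  ultimately have lim_g: "filterlim g (nhds 0) (nhds 0)"
    using tendsto_at_iff_tendsto_nhds[of g 0] by (simp add: continuous_at)
  \<comment> \<open>Facts that hold near 0 in the plane are pulled back along the embedding of the
    reals, and those about \<open>F\<close> along \<open>g\<close>, which tends to 0 at 0.\<close>
  have "\<forall>\<^sub>F x in nhds 0. eval_fps (F oo G) x = f (g x)"
    using filterlim_iff[THEN iffD1, OF lim, rule_format, OF FG(2)]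
      eventually_eval_fps_complex_fps[OF FG(1)] eventually_eval_fps_complex_fps[OF radius(2)]
      filterlim_iff[THEN iffD1, OF lim_g, rule_format, OF eventually_eval_fps_complex_fps[OF radius(1)]]
      F[unfolded has_fps_expansion_def, THEN conjunct2, THEN filterlim_iff[THEN iffD1, OF lim_g, rule_format]]
      G[unfolded has_fps_expansion_def, THEN conjunct2]
  proof eventually_elim
    case (elim x)
    have "complex_of_real (eval_fps (F oo G) x) = eval_fps ?F (eval_fps ?G (of_real x))"
      using elim by simp
    also have "\<dots> = of_real (f (g x))"
      using elim by simp
    finally show ?case by (simp only: of_real_eq_iff)
  qed
  thus ?thesis using FG(1) by (simp add: has_fps_expansion_def)
qed

lemma has_fps_expansion_imp_fps_nth_1:
  fixes f :: "real \<Rightarrow> real"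
  assumes F: "f has_fps_expansion F" and deriv: "(f has_real_derivative D) (at 0)"
  shows "fps_nth F 1 = D"
proof -
  have "(eval_fps F has_field_derivative eval_fps (fps_deriv F) 0) (at 0)"
    using F by (intro has_field_derivative_eval_fps) (auto simp: has_fps_expansion_def zero_ereal_def)
  moreover have "(eval_fps F has_field_derivative D) (at 0)"
    using F deriv by (subst DERIV_cong_ev[OF refl _ refl]) (auto simp: has_fps_expansion_def)
  ultimately show ?thesis
    by (auto dest: DERIV_unique simp: eval_fps_at_0)
qed

text \<open>\<open>fps_prod_nth'\<close> indexes the coefficient by multisets of size
  \<open>m\<close> over \<open>I\<close>. Restricting the multiplicity function to \<open>I\<close>
  identifies these with the extensional tuples of sum \<open>m\<close>.\<close>

lemma fps_prod_nth_PiE: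
  fixes F :: "'i \<Rightarrow> 'a::comm_ring_1 fps"
  assumes "finite I"
  shows "fps_nth (\<Prod>i\<in>I. F i) m =
    (\<Sum>n | n \<in> I \<rightarrow>\<^sub>E (UNIV :: nat set) \<and> (\<Sum>i\<in>I. n i) = m. \<Prod>i\<in>I. fps_nth (F i) (n i))"
proof -
  have count: "count (Abs_multiset (\<lambda>x. if x \<in> I then n x else 0)) = (\<lambda>x. if x \<in> I then n x else 0)" for n
    by (intro count_Abs_multiset finite_subset[OF _ assms]) (auto split: if_splits)
  have size: "size X = (\<Sum>i\<in>I. count X i)" if "set_mset X \<subseteq> I" for X
    unfolding size_multiset_overloaded_eq
    using that assms by (intro sum.mono_neutral_left) (auto simp: count_eq_zero_iff)
  have set: "set_mset (Abs_multiset (\<lambda>x. if x \<in> I then n x else 0)) \<subseteq> I" for n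
    unfolding set_mset_def count by (auto split: if_splits)
  have PiE: "restrict (count X) I \<in> {n. n \<in> I \<rightarrow>\<^sub>E (UNIV :: nat set) \<and> (\<Sum>i\<in>I. n i) = m}"
    if "X \<in> multisets_of_size I m" for X
    using that size[of X] by (simp add: multisets_of_size_def)
  have multiset: "Abs_multiset (\<lambda>x. if x \<in> I then n x else 0) \<in> multisets_of_size I m"
    if "(\<Sum>i\<in>I. n i) = m" for n
    unfolding multisets_of_size_def using that set[of n] size[OF set, of n] by (simp add: count)
  have inverse1: "Abs_multiset (\<lambda>x. if x \<in> I then restrict (count X) I x else 0) = X"
    if "X \<in> multisets_of_size I m" for X
  proof (rule multiset_eqI)
    fix x
    have "x \<notin> I \<Longrightarrow> count X x = 0"
      using that unfolding multisets_of_size_def count_eq_zero_iff by blast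
    thus "count (Abs_multiset (\<lambda>x. if x \<in> I then restrict (count X) I x else 0)) x = count X x"
      unfolding count by simp
  qed
  have inverse2: "restrict (count (Abs_multiset (\<lambda>x. if x \<in> I then n x else 0))) I = n"
    if "n \<in> I \<rightarrow>\<^sub>E (UNIV :: nat set)" for n
  proof -
    have "restrict (count (Abs_multiset (\<lambda>x. if x \<in> I then n x else 0))) I = restrict n I"
      unfolding count by (rule restrict_ext) simp
    thus ?thesis using PiE_restrict[OF that] by simp
  qed
  show ?thesis
    unfolding fps_prod_nth'[OF assms]
  proof (rule sum.reindex_bij_witness[of _ "\<lambda>n. Abs_multiset (\<lambda>x. if x \<in> I then n x else 0)"
        "\<lambda>X. restrict (count X) I"])
    fix X assume "X \<in> multisets_of_size I m"
    show "(\<Prod>i\<in>I. fps_nth (F i) (restrict (count X) I i)) = (\<Prod>i\<in>I. fps_nth (F i) (count X i))"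
      by simp
  qed (use PiE multiset inverse1 inverse2 in blast)+
qed

subsection \<open>Moment series and Sheffer polynomials\<close>

text \<open>The formal Taylor series at 0 of the function sending \<open>t\<close> to E(Y exp(t S)).
  Working with the series turns composition with \<open>U\<close>, and its cancellation, into
  algebra.\<close>

definition moment_fps :: "'a measure \<Rightarrow> ('a \<Rightarrow> real) \<Rightarrow> ('a \<Rightarrow> real) \<Rightarrow> real fps" where
  "moment_fps M Y S = Abs_fps (\<lambda>k. (\<integral>x. Y x * S x ^ k \<partial>M) / fact k)"

lemma has_fps_expansion_moment_fps:
  assumes [measurable]: "Y \<in> borel_measurable M" "S \<in> borel_measurable M"
    and "\<delta> > 0" and int: "integrable M (\<lambda>x. \<bar>Y x\<bar> * exp (\<delta> * \<bar>S x\<bar>))"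
  shows "(\<lambda>t. \<integral>x. Y x * exp (t * S x) \<partial>M) has_fps_expansion moment_fps M Y S"
proof (rule has_fps_expansionI)
  have "\<forall>\<^sub>F t in nhds 0. \<bar>t\<bar> < \<delta>"
    using \<open>\<delta> > 0\<close> by (auto simp: eventually_nhds_metric dist_norm)
  thus "\<forall>\<^sub>F t in nhds 0. (\<lambda>k. fps_nth (moment_fps M Y S) k * t ^ k) sums (\<integral>x. Y x * exp (t * S x) \<partial>M)"
  proof eventually_elim
    case (elim t)
    have "integrable M (\<lambda>x. norm (Y x) * \<bar>S x\<bar> ^ 0 * exp (\<bar>t\<bar> * \<bar>S x\<bar>))"
      by (rule integrable_power_exp[where \<delta> = \<delta>]) (use int elim in auto)
    hence "(\<lambda>k. t ^ k / fact k * (\<integral>x. Y x * of_real (S x) ^ k \<partial>M)) sums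
             (\<integral>x. Y x * exp (t * of_real (S x)) \<partial>M)"
      by (intro exp_integral_sums) auto
    thus ?case by (simp add: moment_fps_def mult_ac)
  qed
qed

lemma borel_measurable_poly [measurable]: "poly (p :: real poly) \<in> borel_measurable borel"
  by (intro borel_measurable_continuous_onI continuous_intros)

lemma integrable_poly_exp:
  fixes Y S :: "'a \<Rightarrow> real"
  assumes [measurable]: "Y \<in> borel_measurable M" "S \<in> borel_measurable M"
    and int: "integrable M (\<lambda>x. \<bar>Y x\<bar> * exp (\<delta> * \<bar>S x\<bar>))" and "\<epsilon> < \<delta>"
  shows "integrable M (\<lambda>x. \<bar>Y x * poly p (S x)\<bar> * exp (\<epsilon> * \<bar>S x\<bar>))"
proof (rule Bochner_Integration.integrable_bound)
  have "integrable M (\<lambda>x. norm (Y x) * \<bar>S x\<bar> ^ i * exp (\<epsilon> * \<bar>S x\<bar>))" for i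
    by (rule integrable_power_exp[where \<delta> = \<delta>]) (use int \<open>\<epsilon> < \<delta>\<close> in auto)
  thus "integrable M (\<lambda>x. \<Sum>i\<le>degree p. \<bar>coeff p i\<bar> * (norm (Y x) * \<bar>S x\<bar> ^ i * exp (\<epsilon> * \<bar>S x\<bar>)))"
    by (intro Bochner_Integration.integrable_sum integrable_mult_right)
  have "\<bar>Y x * poly p (S x)\<bar> * exp (\<epsilon> * \<bar>S x\<bar>) \<le>
      (\<Sum>i\<le>degree p. \<bar>coeff p i\<bar> * (norm (Y x) * \<bar>S x\<bar> ^ i * exp (\<epsilon> * \<bar>S x\<bar>)))" for x
  proof -
    have "\<bar>poly p (S x)\<bar> \<le> (\<Sum>i\<le>degree p. \<bar>coeff p i\<bar> * \<bar>S x\<bar> ^ i)"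
      unfolding poly_altdef by (rule order_trans[OF sum_abs]) (simp add: abs_mult power_abs)
    hence "\<bar>Y x\<bar> * \<bar>poly p (S x)\<bar> * exp (\<epsilon> * \<bar>S x\<bar>) \<le>
        \<bar>Y x\<bar> * (\<Sum>i\<le>degree p. \<bar>coeff p i\<bar> * \<bar>S x\<bar> ^ i) * exp (\<epsilon> * \<bar>S x\<bar>)"
      by (intro mult_left_mono mult_right_mono) auto
    moreover have "\<bar>Y x\<bar> * (\<Sum>i\<le>degree p. \<bar>coeff p i\<bar> * \<bar>S x\<bar> ^ i) * exp (\<epsilon> * \<bar>S x\<bar>) =
        (\<Sum>i\<le>degree p. \<bar>coeff p i\<bar> * (norm (Y x) * \<bar>S x\<bar> ^ i * exp (\<epsilon> * \<bar>S x\<bar>)))"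
      unfolding sum_distrib_left sum_distrib_right by (intro sum.cong refl) simp
    ultimately show ?thesis
      by (simp only: abs_mult)
  qed
  thus "AE x in M. norm (\<bar>Y x * poly p (S x)\<bar> * exp (\<epsilon> * \<bar>S x\<bar>)) \<le>
      norm (\<Sum>i\<le>degree p. \<bar>coeff p i\<bar> * (norm (Y x) * \<bar>S x\<bar> ^ i * exp (\<epsilon> * \<bar>S x\<bar>)))"
    by (intro always_eventually allI) (simp add: abs_of_nonneg sum_nonneg)
qed (measurable)

section \<open>Polynomials generated by exp(x U(z)) A(z)\<close>

text \<open>This is n! times the coefficient of z^n in exp(x U(z)) A(z), sorted by powers of x.
  Terms with \<open>j > n\<close> drop out once \<open>U\<close> has no constant term, since
  \<open>U ^ j\<close> then has no coefficient below order \<open>j\<close>.\<close>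

definition sheffer_poly :: "real fps \<Rightarrow> real fps \<Rightarrow> nat \<Rightarrow> real poly" where
  "sheffer_poly U A n = (\<Sum>j\<le>n. monom (fact n / fact j * fps_nth (U ^ j * A) n) j)"

lemma coeff_sheffer_poly:
  "coeff (sheffer_poly U A n) j = (if j \<le> n then fact n / fact j * fps_nth (U ^ j * A) n else 0)"
  by (simp add: sheffer_poly_def coeff_sum sum.delta)

lemma sheffer_poly_generating_function:
  assumes U0: "fps_nth U 0 = 0"
  shows "Abs_fps (\<lambda>n. poly (sheffer_poly U A n) x / fact n) = (fps_exp x oo U) * A"
proof (rule fps_ext)
  fix n
  \<comment> \<open>For \<open>i \<le> n\<close> the range of \<open>j\<close> is enlarged to
    \<open>j \<le> n\<close>, the added coefficients of \<open>U ^ j\<close> being 0. With a range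
    independent of \<open>i\<close> the two sums can be swapped.\<close>
  have exp_nth: "fps_nth (fps_exp x oo U) i = (\<Sum>j\<le>n. x ^ j / fact j * fps_nth (U ^ j) i)" if "i \<le> n" for i
  proof -
    have "fps_nth (fps_exp x oo U) i = (\<Sum>j\<in>{0..i}. x ^ j / fact j * fps_nth (U ^ j) i)"
      by (simp add: fps_compose_nth)
    also have "\<dots> = (\<Sum>j\<le>n. x ^ j / fact j * fps_nth (U ^ j) i)"
      using that startsby_zero_power_prefix[OF U0] by (intro sum.mono_neutral_left) auto
    finally show ?thesis .
  qed
  let ?G = "\<lambda>i j. x ^ j / fact j * fps_nth (U ^ j) i * fps_nth A (n - i)"
  have "fps_nth ((fps_exp x oo U) * A) n =
      (\<Sum>i=0..n. (\<Sum>j\<le>n. x ^ j / fact j * fps_nth (U ^ j) i) * fps_nth A (n - i))"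
    unfolding fps_mult_nth by (intro sum.cong refl) (simp add: exp_nth)
  also have "\<dots> = (\<Sum>j\<le>n. \<Sum>i=0..n. ?G i j)"
    unfolding sum_distrib_right by (rule sum.swap)
  also have "\<dots> = (\<Sum>j\<le>n. x ^ j / fact j * fps_nth (U ^ j * A) n)"
    unfolding fps_mult_nth sum_distrib_left by (simp only: mult.assoc)
  also have "\<dots> = poly (sheffer_poly U A n) x / fact n"
    by (simp add: sheffer_poly_def poly_sum poly_monom sum_divide_distrib mult_ac)
  finally show "fps_nth (Abs_fps (\<lambda>n. poly (sheffer_poly U A n) x / fact n)) n = fps_nth ((fps_exp x oo U) * A) n"
    by simp
qed

text \<open>In degree \<open>n\<close> of \<open>U ^ n * A\<close> only the lowest terms meet, which
  gives \<open>fps_nth U 1 ^ n * fps_nth A 0\<close>, that is 1.\<close>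

lemma sheffer_poly_monic:
  assumes "fps_nth U 0 = 0" "fps_nth U 1 = 1" "fps_nth A 0 = 1"
  shows "degree (sheffer_poly U A n) = n" "coeff (sheffer_poly U A n) n = 1"
proof -
  have "fps_nth (U ^ n * A) n = (\<Sum>i=0..n. if i = n then fps_nth (U ^ n) n * fps_nth A 0 else 0)"
    unfolding fps_mult_nth using startsby_zero_power_prefix[OF assms(1), of n]
    by (intro sum.cong) auto
  hence "fps_nth (U ^ n * A) n = 1"
    using startsby_zero_power_nth_same[OF assms(1), of n] assms(2,3) by (simp add: sum.delta)
  thus coeff: "coeff (sheffer_poly U A n) n = 1"
    by (simp add: coeff_sheffer_poly)
  show "degree (sheffer_poly U A n) = n"
    using coeff by (intro antisym degree_le le_degree) (auto simp: coeff_sheffer_poly)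
qed

section \<open>Laws with exponential moments\<close>

text \<open>One dominating exponential replaces an interval of parameters: it bounds
  \<open>exp (t * x)\<close> for all \<open>\<bar>t\<bar> \<le> \<delta>\<close> at once.\<close>

definition exp_moments :: "real measure \<Rightarrow> bool" where
  "exp_moments \<mu> \<longleftrightarrow> (\<exists>\<delta>>0. integrable \<mu> (\<lambda>x. exp (\<delta> * \<bar>x\<bar>)))"

abbreviation mgf_fps :: "real measure \<Rightarrow> real fps" where
  "mgf_fps \<mu> \<equiv> moment_fps \<mu> (\<lambda>_. 1) (\<lambda>x. x)"

lemma exp_moments_iff:
  assumes "real_distribution \<mu>"
  shows "exp_moments \<mu> \<longleftrightarrow> (\<exists>a b. a < 0 \<and> 0 < b \<and> (\<forall>t\<in>{a<..<b}. integrable \<mu> (\<lambda>x. exp (t * x))))"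
proof safe
  interpret real_distribution \<mu> by fact
  assume "exp_moments \<mu>"
  then obtain \<delta> where \<delta>: "\<delta> > 0" "integrable \<mu> (\<lambda>x. exp (\<delta> * \<bar>x\<bar>))"
    by (auto simp: exp_moments_def)
  have "integrable \<mu> (\<lambda>x. exp (t * x))" if "t \<in> {-\<delta><..<\<delta>}" for t
  proof (rule Bochner_Integration.integrable_bound[OF \<delta>(2)])
    have "t * x \<le> \<delta> * \<bar>x\<bar>" for x
    proof -
      have "\<bar>t\<bar> * \<bar>x\<bar> \<le> \<delta> * \<bar>x\<bar>" using that by (intro mult_right_mono) auto
      thus ?thesis using abs_ge_self[of "t * x"] by (simp only: abs_mult)
    qed
    thus "AE x in \<mu>. norm (exp (t * x)) \<le> norm (exp (\<delta> * \<bar>x\<bar>))"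
      by simp
  qed auto
  with \<delta>(1) show "\<exists>a b. a < 0 \<and> 0 < b \<and> (\<forall>t\<in>{a<..<b}. integrable \<mu> (\<lambda>x. exp (t * x)))"
    by (intro exI[of _ "-\<delta>"] exI[of _ \<delta>]) auto
next
  interpret real_distribution \<mu> by fact
  fix a b :: real assume ab: "a < 0" "0 < b" "\<forall>t\<in>{a<..<b}. integrable \<mu> (\<lambda>x. exp (t * x))"
  \<comment> \<open>Both \<open>\<delta>\<close> and \<open>- \<delta>\<close> lie in the given
    interval, and the two exponentials together dominate
    \<open>exp (\<delta> * \<bar>x\<bar>)\<close>.\<close>
  define \<delta> where "\<delta> = min (-a) b / 2"
  have "\<delta> > 0" using ab by (simp add: \<delta>_def)
  have "integrable \<mu> (\<lambda>x. exp (\<delta> * x) + exp (-\<delta> * x))"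
    by (intro Bochner_Integration.integrable_add ab(3)[rule_format]) (use ab in \<open>auto simp: \<delta>_def\<close>)
  hence "integrable \<mu> (\<lambda>x. exp (\<delta> * \<bar>x\<bar>))"
  proof (rule Bochner_Integration.integrable_bound)
    have "exp (\<delta> * \<bar>x\<bar>) \<le> \<bar>exp (\<delta> * x) + exp (-\<delta> * x)\<bar>" for x
      using exp_gt_zero[of "\<delta> * x"] exp_gt_zero[of "-\<delta> * x"] by (cases "x \<ge> 0") auto
    thus "AE x in \<mu>. norm (exp (\<delta> * \<bar>x\<bar>)) \<le> norm (exp (\<delta> * x) + exp (-\<delta> * x))"
      by simp
  qed auto
  thus "exp_moments \<mu>" using \<open>\<delta> > 0\<close> by (auto simp: exp_moments_def)
qed

text \<open>Half of the exponential rate absorbs the polynomial and half remains in the conclusion,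
  so that one \<open>\<delta>\<close> serves all polynomials.\<close>

lemma integrable_poly_if_exp_moments:
  assumes "real_distribution \<mu>" "exp_moments \<mu>"
  obtains \<delta> where "\<delta> > 0" "\<And>p. integrable \<mu> (\<lambda>x. \<bar>poly p x\<bar> * exp (\<delta> * \<bar>x\<bar>))"
    "\<And>p. integrable \<mu> (poly p)"
proof -
  interpret real_distribution \<mu> by fact
  obtain \<delta> where \<delta>: "\<delta> > 0" "integrable \<mu> (\<lambda>x. exp (\<delta> * \<bar>x\<bar>))"
    using assms(2) by (auto simp: exp_moments_def)
  have int: "integrable \<mu> (\<lambda>x. \<bar>poly p x\<bar> * exp (\<epsilon> * \<bar>x\<bar>))" if "\<epsilon> < \<delta>" for p \<epsilon>
    using integrable_poly_exp[of "\<lambda>_. 1" \<mu> "\<lambda>x. x" \<delta> \<epsilon> p] \<delta> that by simp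
  have "integrable \<mu> (poly p)" for p
  proof (rule Bochner_Integration.integrable_bound[OF int[of 0 p]])
    show "poly p \<in> borel_measurable \<mu>" by simp
  qed (use \<delta> in auto)
  thus ?thesis using int[of "\<delta> / 2"] \<delta> by (intro that[of "\<delta> / 2"]) auto
qed

subsection \<open>Laws of a Meixner class\<close>

lemma mgf_fps_0:
  assumes "real_distribution \<mu>"
  shows "fps_nth (mgf_fps \<mu>) 0 = 1"
proof -
  interpret real_distribution \<mu> by fact
  show ?thesis using prob_space by (simp add: moment_fps_def)
qed

text \<open>The two normalisations of \<open>U\<close> make right composition with \<open>U\<close>
  injective on formal power series. Cancelling \<open>U\<close> in this way takes the place of the
  inverse function of \<open>u\<close>.\<close>

locale meixner_family =
  fixes u :: "real \<Rightarrow> real" and U :: "real fps"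
  assumes u_expansion: "u has_fps_expansion U" and U0: "fps_nth U 0 = 0" and U1: "fps_nth U 1 = 1"
begin

definition law_poly :: "real measure \<Rightarrow> nat \<Rightarrow> real poly" where
  "law_poly \<mu> = sheffer_poly U (inverse (mgf_fps \<mu> oo U))"

text \<open>Positive variance is left out: the law of a sum is first shown to be orthogonal, and its
  variance is computed from that.\<close>

definition orthogonal_law :: "real measure \<Rightarrow> bool" where
  "orthogonal_law \<mu> \<longleftrightarrow> real_distribution \<mu> \<and> exp_moments \<mu> \<and>
     (\<forall>m n. m \<noteq> n \<longrightarrow> (\<integral>x. poly (law_poly \<mu> m) x * poly (law_poly \<mu> n) x \<partial>\<mu>) = 0)"

lemma law_poly_monic:
  assumes "real_distribution \<mu>"
  shows "degree (law_poly \<mu> n) = n" "coeff (law_poly \<mu> n) n = 1"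
  unfolding law_poly_def by (intro sheffer_poly_monic U0 U1; simp add: mgf_fps_0[OF assms])+

lemma law_poly_generating_function:
  "Abs_fps (\<lambda>n. poly (law_poly \<mu> n) x / fact n) = (fps_exp x oo U) * inverse (mgf_fps \<mu> oo U)"
  unfolding law_poly_def by (rule sheffer_poly_generating_function[OF U0])

text \<open>For each real \<open>x\<close> the expansion of the generating function is unique, and a
  real polynomial is determined by its values. This settles the definite description in
  \<open>meixner_poly\<close>.\<close>

lemma meixner_polys_iff:
  assumes "real_distribution \<mu>" "exp_moments \<mu>"
  shows "meixner_polys u \<mu> P \<longleftrightarrow> P = law_poly \<mu>"
proof -
  interpret real_distribution \<mu> by fact
  obtain \<delta> where \<delta>: "\<delta> > 0" "integrable \<mu> (\<lambda>x. exp (\<delta> * \<bar>x\<bar>))"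
    using assms(2) by (auto simp: exp_moments_def)
  have "mgf \<mu> has_fps_expansion mgf_fps \<mu>"
    using has_fps_expansion_moment_fps[of "\<lambda>_. 1" \<mu> "\<lambda>x. x" \<delta>] \<delta> by (simp add: mgf_def[abs_def])
  hence "(\<lambda>z. mgf \<mu> (u z)) has_fps_expansion (mgf_fps \<mu> oo U)"
    by (rule has_fps_expansion_compose_real[OF _ u_expansion U0])
  hence inv: "(\<lambda>z. inverse (mgf \<mu> (u z))) has_fps_expansion inverse (mgf_fps \<mu> oo U)"
    by (rule has_fps_expansion_inverse) (simp add: mgf_fps_0[OF assms(1)])
  have "(\<lambda>z. exp (x * u z)) has_fps_expansion (fps_exp x oo U)" for x
    by (rule has_fps_expansion_compose_real[OF has_fps_expansion_exp u_expansion U0])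
  from has_fps_expansion_mult[OF this inv]
  have expansion: "(\<lambda>z. exp (x * u z) / mgf \<mu> (u z)) has_fps_expansion
      Abs_fps (\<lambda>n. poly (law_poly \<mu> n) x / fact n)" for x
    by (simp add: law_poly_generating_function divide_inverse[of "exp _"])
  show ?thesis
  proof
    assume "P = law_poly \<mu>"
    thus "meixner_polys u \<mu> P"
      using expansion law_poly_monic[OF assms(1)] by (simp add: meixner_polys_def)
  next
    assume "meixner_polys u \<mu> P"
    hence "Abs_fps (\<lambda>n. poly (P n) x / fact n) = Abs_fps (\<lambda>n. poly (law_poly \<mu> n) x / fact n)" for x
      using fps_expansion_unique[OF _ expansion] unfolding meixner_polys_def by blast
    hence "poly (P n) x = poly (law_poly \<mu> n) x" for n x
      by (simp add: fps_eq_iff)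
    thus "P = law_poly \<mu>"
      by (simp add: fun_eq_iff poly_eq_poly_eq_iff[symmetric])
  qed
qed

lemma meixner_class_iff: "\<mu> \<in> meixner_class u \<longleftrightarrow> orthogonal_law \<mu> \<and> law_variance \<mu> > 0"
proof (cases "real_distribution \<mu> \<and> exp_moments \<mu>")
  case True
  thus ?thesis
    using exp_moments_iff[of \<mu>] by (simp add: meixner_class_def orthogonal_law_def meixner_polys_iff conj_commute)
next
  case False
  thus ?thesis
    using exp_moments_iff[of \<mu>] unfolding meixner_class_def orthogonal_law_def mem_Collect_eq by blast
qed

text \<open>Coefficients are compared: the generating function, solved for the exponential, expands
  the integrand in the \<open>P i\<close>, and orthogonality leaves the index \<open>i = n\<close>.
  Each coefficient involves finite sums only, so the integral passes through by linearity.\<close>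

lemma moment_fps_law_poly:
  assumes "orthogonal_law \<mu>"
  shows "moment_fps \<mu> (poly (law_poly \<mu> n)) (\<lambda>x. x) oo U =
    fps_const ((\<integral>x. (poly (law_poly \<mu> n) x)\<^sup>2 \<partial>\<mu>) / fact n) * fps_X ^ n * (mgf_fps \<mu> oo U)"
proof (rule fps_ext)
  fix k
  have \<mu>: "real_distribution \<mu>" "exp_moments \<mu>"
    and orth: "\<And>m n. m \<noteq> n \<Longrightarrow> (\<integral>x. poly (law_poly \<mu> m) x * poly (law_poly \<mu> n) x \<partial>\<mu>) = 0"
    using assms by (auto simp: orthogonal_law_def)
  interpret real_distribution \<mu> by fact
  define P where "P = law_poly \<mu>"
  define B where "B = mgf_fps \<mu> oo U"
  have int: "integrable \<mu> (poly p)" for p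
    using integrable_poly_if_exp_moments[OF \<mu>] by metis
  have int_power: "integrable \<mu> (\<lambda>x. poly p x * x ^ j)" for p j
  proof -
    have "poly (p * monom 1 j) = (\<lambda>x. poly p x * x ^ j)"
      by (simp add: fun_eq_iff poly_monom)
    thus ?thesis using int[of "p * monom 1 j"] by simp
  qed
  have int_mult: "integrable \<mu> (\<lambda>x. poly p x * poly q x)" for p q
  proof -
    have "poly (p * q) = (\<lambda>x. poly p x * poly q x)"
      by (simp add: fun_eq_iff)
    thus ?thesis using int[of "p * q"] by simp
  qed
  have B0: "fps_nth B 0 = 1" by (simp add: B_def mgf_fps_0[OF \<mu>(1)])
  have exp_eq: "fps_exp x oo U = Abs_fps (\<lambda>n. poly (P n) x / fact n) * B" for x
    unfolding P_def law_poly_generating_function B_def[symmetric] mult.assoc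
    using B0 by (simp add: inverse_mult_eq_1)
  have "fps_nth (moment_fps \<mu> (poly (P n)) (\<lambda>x. x) oo U) k =
      (\<Sum>j=0..k. (\<integral>x. poly (P n) x * x ^ j \<partial>\<mu>) * (fps_nth (U ^ j) k / fact j))"
    by (simp add: fps_compose_nth moment_fps_def)
  also have "\<dots> = (\<integral>x. (\<Sum>j=0..k. (poly (P n) x * x ^ j) * (fps_nth (U ^ j) k / fact j)) \<partial>\<mu>)"
    by (subst Bochner_Integration.integral_sum) (auto intro!: integrable_mult_left int_power)
  also have "\<dots> = (\<integral>x. poly (P n) x * fps_nth (fps_exp x oo U) k \<partial>\<mu>)"
    by (simp add: fps_compose_nth sum_distrib_left mult_ac)
  also have "\<dots> = (\<integral>x. (\<Sum>i=0..k. (poly (P n) x * poly (P i) x) * (fps_nth B (k - i) / fact i)) \<partial>\<mu>)"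
    unfolding exp_eq fps_mult_nth sum_distrib_left by (simp add: mult_ac)
  also have "\<dots> = (\<Sum>i=0..k. (\<integral>x. poly (P n) x * poly (P i) x \<partial>\<mu>) * (fps_nth B (k - i) / fact i))"
    by (subst Bochner_Integration.integral_sum) (auto intro!: integrable_mult_left int_mult)
  \<comment> \<open>For \<open>k < n\<close> the index \<open>n\<close> does not occur, in
    accordance with the factor \<open>fps_X ^ n\<close>.\<close>
  also have "\<dots> = (\<Sum>i=0..k. if i = n then (\<integral>x. (poly (P n) x)\<^sup>2 \<partial>\<mu>) * (fps_nth B (k - n) / fact n) else 0)"
    by (intro sum.cong refl) (auto simp: P_def orth power2_eq_square)
  also have "\<dots> = fps_nth (fps_const ((\<integral>x. (poly (P n) x)\<^sup>2 \<partial>\<mu>) / fact n) * fps_X ^ n * B) k"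
    by (simp add: mult.assoc fps_X_power_mult_nth)
  finally show "fps_nth (moment_fps \<mu> (poly (law_poly \<mu> n)) (\<lambda>x. x) oo U) k =
      fps_nth (fps_const ((\<integral>x. (poly (law_poly \<mu> n) x)\<^sup>2 \<partial>\<mu>) / fact n) * fps_X ^ n * (mgf_fps \<mu> oo U)) k"
    unfolding P_def B_def .
qed

lemma law_poly_0:
  assumes "real_distribution \<mu>"
  shows "law_poly \<mu> 0 = 1"
  using law_poly_monic[OF assms, of 0] by (metis degree_eq_zeroE coeff_pCons_0 one_pCons)

text \<open>Orthogonality to the constant \<open>law_poly \<mu> 0\<close> forces the monic linear
  polynomial to have mean 0.\<close>

lemma law_poly_1:
  assumes "orthogonal_law \<mu>"
  shows "law_poly \<mu> 1 = [:- law_mean \<mu>, 1:]"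
proof -
  have \<mu>: "real_distribution \<mu>" "exp_moments \<mu>"
    using assms by (auto simp: orthogonal_law_def)
  interpret real_distribution \<mu> by fact
  have int: "integrable \<mu> (poly p)" for p
    using integrable_poly_if_exp_moments[OF \<mu>] by metis
  obtain a b where ab: "law_poly \<mu> 1 = [:a, b:]"
    using law_poly_monic(1)[OF \<mu>(1), of 1] degree1_coeffs by metis
  with law_poly_monic(2)[OF \<mu>(1), of 1] have "b = 1" by simp
  have "(\<integral>x. poly (law_poly \<mu> 1) x * poly (law_poly \<mu> 0) x \<partial>\<mu>) = 0"
    using assms by (auto simp: orthogonal_law_def)
  moreover have "poly [:0, 1:] = (\<lambda>x :: real. x)"
    by (simp add: fun_eq_iff)
  ultimately have "a + law_mean \<mu> = 0"
    using int[of "[:0, 1:]"] prob_space ab \<open>b = 1\<close> by (simp add: law_poly_0[OF \<mu>(1)] law_mean_def)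
  thus ?thesis using ab \<open>b = 1\<close> by (simp add: eq_neg_iff_add_eq_0)
qed

text \<open>Case \<open>n = 1\<close> of \<open>moment_fps_law_poly\<close>. Multiplying the
  integrand by \<open>x\<close> differentiates the moment series, and the squared norm of the
  centred linear polynomial is the variance.\<close>

lemma mgf_fps_deriv_compose:
  assumes "orthogonal_law \<mu>"
  shows "fps_deriv (mgf_fps \<mu>) oo U =
    (fps_const (law_mean \<mu>) + fps_const (law_variance \<mu>) * fps_X) * (mgf_fps \<mu> oo U)"
proof -
  have \<mu>: "real_distribution \<mu>" "exp_moments \<mu>"
    using assms by (auto simp: orthogonal_law_def)
  interpret real_distribution \<mu> by fact
  have int: "integrable \<mu> (poly p)" for p
    using integrable_poly_if_exp_moments[OF \<mu>] by metis
  have int_power: "integrable \<mu> (\<lambda>x. x ^ j)" for j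
  proof -
    have "poly (monom 1 j) = (\<lambda>x. x ^ j :: real)"
      by (simp add: fun_eq_iff poly_monom)
    thus ?thesis using int[of "monom 1 j"] by simp
  qed
  have "fps_nth (moment_fps \<mu> (poly (law_poly \<mu> 1)) (\<lambda>x. x)) k =
      fps_nth (fps_deriv (mgf_fps \<mu>) - fps_const (law_mean \<mu>) * mgf_fps \<mu>) k" for k
  proof -
    have "(\<integral>x. poly (law_poly \<mu> 1) x * x ^ k \<partial>\<mu>) = (\<integral>x. x ^ Suc k - law_mean \<mu> * x ^ k \<partial>\<mu>)"
      by (simp add: law_poly_1[OF assms, unfolded One_nat_def] algebra_simps)
    also have "\<dots> = (\<integral>x. x ^ Suc k \<partial>\<mu>) - law_mean \<mu> * (\<integral>x. x ^ k \<partial>\<mu>)"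
      using int_power[of "Suc k"] int_power[of k] by simp
    finally show ?thesis
      by (simp add: moment_fps_def field_simps del: of_nat_Suc)
  qed
  hence "moment_fps \<mu> (poly (law_poly \<mu> 1)) (\<lambda>x. x) =
      fps_deriv (mgf_fps \<mu>) - fps_const (law_mean \<mu>) * mgf_fps \<mu>"
    by (rule fps_ext)
  hence "fps_deriv (mgf_fps \<mu>) oo U =
      (moment_fps \<mu> (poly (law_poly \<mu> 1)) (\<lambda>x. x) + fps_const (law_mean \<mu>) * mgf_fps \<mu>) oo U"
    by simp
  also have "\<dots> = (moment_fps \<mu> (poly (law_poly \<mu> 1)) (\<lambda>x. x) oo U) + fps_const (law_mean \<mu>) * (mgf_fps \<mu> oo U)"
    by (simp add: fps_compose_add_distrib fps_compose_mult_distrib[OF U0])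
  also have "(\<integral>x. (poly (law_poly \<mu> 1) x)\<^sup>2 \<partial>\<mu>) = law_variance \<mu>"
    by (simp add: law_poly_1[OF assms, unfolded One_nat_def] law_variance_def)
  hence "(moment_fps \<mu> (poly (law_poly \<mu> 1)) (\<lambda>x. x) oo U) =
      fps_const (law_variance \<mu>) * fps_X * (mgf_fps \<mu> oo U)"
    using moment_fps_law_poly[OF assms, of 1] by simp
  finally show ?thesis
    by (simp add: algebra_simps)
qed

text \<open>Once \<open>U\<close> is cancelled, the differential equation gives both moment series
  the same logarithmic derivative. Their quotient is then constant with constant term 1, so all
  moments agree, and under exponential moments these determine the law.\<close>

lemma orthogonal_law_unique:
  assumes "orthogonal_law \<mu>" "orthogonal_law \<nu>"
    and "law_mean \<mu> = law_mean \<nu>" "law_variance \<mu> = law_variance \<nu>"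
  shows "\<mu> = \<nu>"
proof -
  have \<mu>: "real_distribution \<mu>" "exp_moments \<mu>" and \<nu>: "real_distribution \<nu>" "exp_moments \<nu>"
    using assms by (auto simp: orthogonal_law_def)
  define F G where "F = mgf_fps \<mu>" and "G = mgf_fps \<nu>"
  have G0: "fps_nth G 0 = 1" "fps_nth F 0 = 1"
    by (simp_all add: F_def G_def mgf_fps_0 \<mu> \<nu>)
  have "(fps_deriv F * G - F * fps_deriv G) oo U = 0"
    using mgf_fps_deriv_compose[OF assms(1)] mgf_fps_deriv_compose[OF assms(2)] assms(3,4)
    unfolding F_def G_def
    by (simp add: fps_compose_sub_distrib fps_compose_mult_distrib[OF U0] mult_ac)
  hence eq: "fps_deriv F * G = F * fps_deriv G"
    using fps_compose_inj_right[OF U0, of "fps_deriv F * G - F * fps_deriv G" 0] U1 by simp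
  have "fps_deriv (F * inverse G) = (fps_deriv F * G - F * fps_deriv G) * (inverse G)\<^sup>2"
  proof -
    have "fps_deriv F * G * (inverse G)\<^sup>2 = fps_deriv F * inverse G"
      using inverse_mult_eq_1'[of G] G0 by (simp add: power2_eq_square mult.assoc[symmetric])
    thus ?thesis using G0 by (auto simp: fps_inverse_deriv algebra_simps)
  qed
  hence "fps_deriv (F * inverse G) = 0"
    by (simp only: eq diff_self mult_zero_left)
  hence "F * inverse G = fps_const (fps_nth (F * inverse G) 0)"
    by (simp only: fps_deriv_eq_0_iff)
  hence "F * inverse G = 1"
    using G0 by simp
  hence "F = G"
    using inverse_mult_eq_1[of G] G0 by (metis mult.assoc mult.commute mult.right_neutral zero_neq_one)
  hence moments: "(\<integral>x. x ^ k \<partial>\<mu>) = (\<integral>x. x ^ k \<partial>\<nu>)" for k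
    by (simp add: F_def G_def fps_eq_iff moment_fps_def)
  obtain \<delta>\<^sub>1 \<delta>\<^sub>2 where \<delta>: "\<delta>\<^sub>1 > 0" "integrable \<mu> (\<lambda>x. exp (\<delta>\<^sub>1 * \<bar>x\<bar>))"
      "\<delta>\<^sub>2 > 0" "integrable \<nu> (\<lambda>x. exp (\<delta>\<^sub>2 * \<bar>x\<bar>))"
    using \<mu>(2) \<nu>(2) by (auto simp: exp_moments_def)
  show ?thesis
  proof (rule real_distribution_eq_if_moments_eq[OF \<mu>(1) \<nu>(1) _ _ _ moments])
    show "min \<delta>\<^sub>1 \<delta>\<^sub>2 > 0" using \<delta> by simp
    interpret \<mu>: real_distribution \<mu> by fact
    interpret \<nu>: real_distribution \<nu> by fact
    show "integrable \<mu> (\<lambda>x. exp (min \<delta>\<^sub>1 \<delta>\<^sub>2 * \<bar>x\<bar>))"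
      by (rule Bochner_Integration.integrable_bound[OF \<delta>(2)]) (auto intro!: mult_right_mono)
    show "integrable \<nu> (\<lambda>x. exp (min \<delta>\<^sub>1 \<delta>\<^sub>2 * \<bar>x\<bar>))"
      by (rule Bochner_Integration.integrable_bound[OF \<delta>(4)]) (auto intro!: mult_right_mono)
  qed
qed

text \<open>Uniqueness of the law with given mean and variance resolves the definite description in
  \<open>meixner_law\<close>.\<close>

lemma meixner_law_eq:
  assumes "\<mu> \<in> meixner_class u"
  shows "meixner_law u (law_mean \<mu>, law_variance \<mu>) = \<mu>"
  unfolding meixner_law_def
  using assms by (intro the_equality) (auto simp: meixner_class_iff intro: orthogonal_law_unique)

lemma meixner_poly_eq:
  assumes "\<mu> \<in> meixner_class u"
  shows "meixner_poly u (law_mean \<mu>, law_variance \<mu>) = law_poly \<mu>"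
  unfolding meixner_poly_def meixner_law_eq[OF assms]
  using assms meixner_polys_iff[of \<mu>]
  by (auto simp: meixner_class_iff orthogonal_law_def)

end

subsection \<open>Sums of independent laws\<close>

lemma moment_fps_distr:
  assumes [measurable]: "X \<in> borel_measurable M" "f \<in> borel_measurable borel"
  shows "moment_fps (distr M borel X) f (\<lambda>x. x) = moment_fps M (\<lambda>\<omega>. f (X \<omega>)) X"
  by (simp add: moment_fps_def integral_distr)

locale independent_meixner = meixner_family u U + prob_space M
  for u :: "real \<Rightarrow> real" and U :: "real fps" and M :: "'a measure" +
  fixes I :: "'i set" and X :: "'i \<Rightarrow> 'a \<Rightarrow> real"
  assumes finite_I: "finite I" and nonempty_I: "I \<noteq> {}"
    and indep_X: "indep_vars (\<lambda>_. borel) X I"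
    and law_X: "\<And>i. i \<in> I \<Longrightarrow> distr M borel (X i) \<in> meixner_class u"
begin

definition law :: "'i \<Rightarrow> real measure" where
  "law i = distr M borel (X i)"

definition P :: "'i \<Rightarrow> nat \<Rightarrow> real poly" where
  "P i = law_poly (law i)"

definition H :: "'i \<Rightarrow> nat \<Rightarrow> real" where
  "H i n = (\<integral>x. (poly (P i n) x)\<^sup>2 \<partial>law i)"

definition S :: "'a \<Rightarrow> real" where
  "S \<omega> = (\<Sum>i\<in>I. X i \<omega>)"

definition sum_law :: "real measure" where
  "sum_law = distr M borel S"

definition Q :: "nat \<Rightarrow> real poly" where
  "Q = law_poly sum_law"

definition K :: "nat \<Rightarrow> real" where
  "K n = (\<integral>x. (poly (Q n) x)\<^sup>2 \<partial>sum_law)"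

lemma X_measurable [measurable]: "i \<in> I \<Longrightarrow> X i \<in> borel_measurable M"
  using indep_X by (simp add: indep_vars_def)

lemma S_measurable [measurable]: "S \<in> borel_measurable M"
  unfolding S_def[abs_def] by measurable

lemma prod_X_measurable [measurable]: "(\<lambda>\<omega>. \<Prod>i\<in>I. poly (q i) (X i \<omega>)) \<in> borel_measurable M"
  by (intro borel_measurable_prod) measurable

lemma orthogonal_law_law: "i \<in> I \<Longrightarrow> orthogonal_law (law i)"
  using law_X[of i] by (simp add: law_def meixner_class_iff)

lemma law_variance_pos: "i \<in> I \<Longrightarrow> law_variance (law i) > 0"
  using law_X[of i] by (simp add: law_def meixner_class_iff)

lemma real_distribution_law: "i \<in> I \<Longrightarrow> real_distribution (law i)"
  using orthogonal_law_law[of i] by (simp add: orthogonal_law_def)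

lemma real_distribution_sum_law: "real_distribution sum_law"
  unfolding sum_law_def by (rule real_distribution_distr) measurable

lemma indep_compose:
  assumes "\<And>i. i \<in> I \<Longrightarrow> f i \<in> borel_measurable borel"
  shows "indep_vars (\<lambda>_. borel) (\<lambda>i \<omega>. f i (X i \<omega>)) I"
  using indep_vars_compose2[OF indep_X assms] by simp

lemma exp_integrable:
  "\<exists>\<delta>>0. \<forall>i\<in>I. \<forall>q. integrable M (\<lambda>\<omega>. \<bar>poly q (X i \<omega>)\<bar> * exp (\<delta> * \<bar>X i \<omega>\<bar>))"
proof -
  have "\<exists>\<delta>>0. \<forall>q. integrable (law i) (\<lambda>x. \<bar>poly q x\<bar> * exp (\<delta> * \<bar>x\<bar>))" if "i \<in> I" for i
    using integrable_poly_if_exp_moments[of "law i"] orthogonal_law_law[OF that]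
    unfolding orthogonal_law_def by metis
  then obtain \<delta> where \<delta>: "\<And>i. i \<in> I \<Longrightarrow> \<delta> i > 0"
      "\<And>i q. i \<in> I \<Longrightarrow> integrable (law i) (\<lambda>x. \<bar>poly q x\<bar> * exp (\<delta> i * \<bar>x\<bar>))"
    by metis
  \<comment> \<open>Finitely many laws share the smallest of their rates.\<close>
  define \<epsilon> where "\<epsilon> = Min (\<delta> ` I)"
  have "\<epsilon> > 0" and \<epsilon>_le: "\<And>i. i \<in> I \<Longrightarrow> \<epsilon> \<le> \<delta> i"
    using \<delta>(1) finite_I nonempty_I by (auto simp: \<epsilon>_def)
  have "integrable M (\<lambda>\<omega>. \<bar>poly q (X i \<omega>)\<bar> * exp (\<epsilon> * \<bar>X i \<omega>\<bar>))" if i: "i \<in> I" for i q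
  proof (rule Bochner_Integration.integrable_bound)
    show "integrable M (\<lambda>\<omega>. \<bar>poly q (X i \<omega>)\<bar> * exp (\<delta> i * \<bar>X i \<omega>\<bar>))"
      using \<delta>(2)[OF i, of q] i by (simp add: law_def integrable_distr_eq)
    have "\<epsilon> * \<bar>X i \<omega>\<bar> \<le> \<delta> i * \<bar>X i \<omega>\<bar>" for \<omega>
      using \<epsilon>_le[OF i] by (intro mult_right_mono) auto
    thus "AE \<omega> in M. norm (\<bar>poly q (X i \<omega>)\<bar> * exp (\<epsilon> * \<bar>X i \<omega>\<bar>)) \<le>
        norm (\<bar>poly q (X i \<omega>)\<bar> * exp (\<delta> i * \<bar>X i \<omega>\<bar>))"
      by (intro always_eventually allI) (simp add: mult_left_mono)
  qed (use i in measurable)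
  with \<open>\<epsilon> > 0\<close> show ?thesis by blast
qed

text \<open>The triangle inequality for \<open>S\<close> bounds the integrand by a product of
  independent integrable factors. The same \<open>\<delta>\<close> is kept for the single variables
  because \<open>moment_fps_prod\<close> needs both bounds together.\<close>

lemma exp_integrable_prod:
  "\<exists>\<delta>>0. (\<forall>i\<in>I. \<forall>q. integrable M (\<lambda>\<omega>. \<bar>poly q (X i \<omega>)\<bar> * exp (\<delta> * \<bar>X i \<omega>\<bar>))) \<and>
     (\<forall>q. integrable M (\<lambda>\<omega>. \<bar>\<Prod>i\<in>I. poly (q i) (X i \<omega>)\<bar> * exp (\<delta> * \<bar>S \<omega>\<bar>)))"
proof -
  obtain \<delta> where \<delta>: "\<delta> > 0" "\<forall>i\<in>I. \<forall>q. integrable M (\<lambda>\<omega>. \<bar>poly q (X i \<omega>)\<bar> * exp (\<delta> * \<bar>X i \<omega>\<bar>))"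
    using exp_integrable by blast
  have "integrable M (\<lambda>\<omega>. \<bar>\<Prod>i\<in>I. poly (q i) (X i \<omega>)\<bar> * exp (\<delta> * \<bar>S \<omega>\<bar>))" for q
  proof (rule Bochner_Integration.integrable_bound)
    show "integrable M (\<lambda>\<omega>. \<Prod>i\<in>I. \<bar>poly (q i) (X i \<omega>)\<bar> * exp (\<delta> * \<bar>X i \<omega>\<bar>))"
      using \<delta>(2) by (intro indep_vars_integrable finite_I indep_compose) auto
    have "\<bar>\<Prod>i\<in>I. poly (q i) (X i \<omega>)\<bar> * exp (\<delta> * \<bar>S \<omega>\<bar>) \<le>
        (\<Prod>i\<in>I. \<bar>poly (q i) (X i \<omega>)\<bar> * exp (\<delta> * \<bar>X i \<omega>\<bar>))" for \<omega>
    proof -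
      have "\<delta> * \<bar>S \<omega>\<bar> \<le> \<delta> * (\<Sum>i\<in>I. \<bar>X i \<omega>\<bar>)"
        unfolding S_def using \<delta>(1) by (intro mult_left_mono sum_abs) auto
      hence "exp (\<delta> * \<bar>S \<omega>\<bar>) \<le> exp (\<Sum>i\<in>I. \<delta> * \<bar>X i \<omega>\<bar>)"
        by (simp only: exp_le_cancel_iff sum_distrib_left)
      hence "exp (\<delta> * \<bar>S \<omega>\<bar>) \<le> (\<Prod>i\<in>I. exp (\<delta> * \<bar>X i \<omega>\<bar>))"
        by (simp only: exp_sum[OF finite_I])
      thus ?thesis
        by (simp add: abs_prod prod.distrib mult_left_mono prod_nonneg)
    qed
    thus "AE \<omega> in M. norm (\<bar>\<Prod>i\<in>I. poly (q i) (X i \<omega>)\<bar> * exp (\<delta> * \<bar>S \<omega>\<bar>)) \<le>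
        norm (\<Prod>i\<in>I. \<bar>poly (q i) (X i \<omega>)\<bar> * exp (\<delta> * \<bar>X i \<omega>\<bar>))"
      by (intro always_eventually allI) (simp add: abs_of_nonneg prod_nonneg)
  qed measurable
  with \<delta> show ?thesis by blast
qed

lemma integrable_prod: "integrable M (\<lambda>\<omega>. \<Prod>i\<in>I. poly (q i) (X i \<omega>))"
proof -
  obtain \<delta> where \<delta>: "\<delta> > 0" "\<forall>i\<in>I. \<forall>q. integrable M (\<lambda>\<omega>. \<bar>poly q (X i \<omega>)\<bar> * exp (\<delta> * \<bar>X i \<omega>\<bar>))"
    "\<forall>q. integrable M (\<lambda>\<omega>. \<bar>\<Prod>i\<in>I. poly (q i) (X i \<omega>)\<bar> * exp (\<delta> * \<bar>S \<omega>\<bar>))"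
    using exp_integrable_prod by blast
  show ?thesis
  proof (rule Bochner_Integration.integrable_bound[OF \<delta>(3)[rule_format, of q]])
    have "\<bar>\<Prod>i\<in>I. poly (q i) (X i \<omega>)\<bar> * 1 \<le> \<bar>\<Prod>i\<in>I. poly (q i) (X i \<omega>)\<bar> * exp (\<delta> * \<bar>S \<omega>\<bar>)" for \<omega>
      using \<delta>(1) by (intro mult_left_mono) auto
    thus "AE \<omega> in M. norm (\<Prod>i\<in>I. poly (q i) (X i \<omega>)) \<le>
        norm (\<bar>\<Prod>i\<in>I. poly (q i) (X i \<omega>)\<bar> * exp (\<delta> * \<bar>S \<omega>\<bar>))"
      by (simp add: abs_mult)
  qed measurable
qed

lemma expectation_prod:
  "(\<integral>\<omega>. (\<Prod>i\<in>I. poly (q i) (X i \<omega>)) \<partial>M) = (\<Prod>i\<in>I. \<integral>x. poly (q i) x \<partial>law i)"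
proof -
  have int: "integrable M (\<lambda>\<omega>. poly (q i) (X i \<omega>))" if "i \<in> I" for i
  proof -
    interpret law: real_distribution "law i" by (rule real_distribution_law[OF that])
    have "integrable (law i) (poly (q i))"
      using integrable_poly_if_exp_moments[of "law i"] orthogonal_law_law[OF that]
      unfolding orthogonal_law_def by metis
    thus ?thesis using that by (simp add: law_def integrable_distr_eq)
  qed
  have "(\<integral>\<omega>. (\<Prod>i\<in>I. poly (q i) (X i \<omega>)) \<partial>M) = (\<Prod>i\<in>I. \<integral>\<omega>. poly (q i) (X i \<omega>) \<partial>M)"
    using int by (intro indep_vars_lebesgue_integral finite_I indep_compose) auto
  also have "\<dots> = (\<Prod>i\<in>I. \<integral>x. poly (q i) x \<partial>law i)"
    by (intro prod.cong refl) (simp add: law_def integral_distr)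
  finally show ?thesis .
qed

lemma exp_moments_sum_law: "exp_moments sum_law"
proof -
  obtain \<delta> where \<delta>: "\<delta> > 0" "\<forall>i\<in>I. \<forall>q. integrable M (\<lambda>\<omega>. \<bar>poly q (X i \<omega>)\<bar> * exp (\<delta> * \<bar>X i \<omega>\<bar>))"
    "\<forall>q. integrable M (\<lambda>\<omega>. \<bar>\<Prod>i\<in>I. poly (q i) (X i \<omega>)\<bar> * exp (\<delta> * \<bar>S \<omega>\<bar>))"
    using exp_integrable_prod by blast
  have "integrable sum_law (\<lambda>x. exp (\<delta> * \<bar>x\<bar>))"
    using \<delta>(3)[rule_format, of "\<lambda>_. 1"] by (simp add: sum_law_def integrable_distr_eq)
  thus ?thesis using \<delta>(1) by (auto simp: exp_moments_def)
qed

text \<open>Near \<open>t = 0\<close>, independence factorises the expectation of the product times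
  \<open>exp (t * S \<omega>)\<close>. Both sides are expansions of this one function of
  \<open>t\<close>, and such an expansion is unique.\<close>

lemma moment_fps_prod:
  "moment_fps M (\<lambda>\<omega>. \<Prod>i\<in>I. poly (q i) (X i \<omega>)) S = (\<Prod>i\<in>I. moment_fps (law i) (poly (q i)) (\<lambda>x. x))"
proof -
  obtain \<delta> where \<delta>: "\<delta> > 0" "\<forall>i\<in>I. \<forall>q. integrable M (\<lambda>\<omega>. \<bar>poly q (X i \<omega>)\<bar> * exp (\<delta> * \<bar>X i \<omega>\<bar>))"
    "\<forall>q. integrable M (\<lambda>\<omega>. \<bar>\<Prod>i\<in>I. poly (q i) (X i \<omega>)\<bar> * exp (\<delta> * \<bar>S \<omega>\<bar>))"
    using exp_integrable_prod by blast
  have "(\<lambda>t. \<Prod>i\<in>I. \<integral>\<omega>. poly (q i) (X i \<omega>) * exp (t * X i \<omega>) \<partial>M) has_fps_expansion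
      (\<Prod>i\<in>I. moment_fps M (\<lambda>\<omega>. poly (q i) (X i \<omega>)) (X i))"
    using \<delta>(2) by (intro has_fps_expansion_prod has_fps_expansion_moment_fps[OF _ _ \<delta>(1)]) auto
  moreover have "\<forall>\<^sub>F t in nhds 0. (\<Prod>i\<in>I. \<integral>\<omega>. poly (q i) (X i \<omega>) * exp (t * X i \<omega>) \<partial>M) =
      (\<integral>\<omega>. (\<Prod>i\<in>I. poly (q i) (X i \<omega>)) * exp (t * S \<omega>) \<partial>M)"
  proof -
    have "\<forall>\<^sub>F t in nhds 0. \<bar>t\<bar> < \<delta>"
      using \<delta>(1) by (auto simp: eventually_nhds_metric dist_norm)
    thus ?thesis
    proof eventually_elim
      case (elim t)
      have int: "integrable M (\<lambda>\<omega>. poly (q i) (X i \<omega>) * exp (t * X i \<omega>))" if i: "i \<in> I" for i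
      proof (rule Bochner_Integration.integrable_bound[OF \<delta>(2)[rule_format, OF i, of "q i"]])
        have "t * X i \<omega> \<le> \<delta> * \<bar>X i \<omega>\<bar>" for \<omega>
        proof -
          have "\<bar>t\<bar> * \<bar>X i \<omega>\<bar> \<le> \<delta> * \<bar>X i \<omega>\<bar>" using elim by (intro mult_right_mono) auto
          thus ?thesis using abs_ge_self[of "t * X i \<omega>"] by (simp only: abs_mult)
        qed
        thus "AE \<omega> in M. norm (poly (q i) (X i \<omega>) * exp (t * X i \<omega>)) \<le>
            norm (\<bar>poly (q i) (X i \<omega>)\<bar> * exp (\<delta> * \<bar>X i \<omega>\<bar>))"
          by (intro always_eventually allI) (simp add: abs_mult mult_left_mono)
      qed (use i in measurable)
      have "(\<integral>\<omega>. (\<Prod>i\<in>I. poly (q i) (X i \<omega>) * exp (t * X i \<omega>)) \<partial>M) =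
          (\<Prod>i\<in>I. \<integral>\<omega>. poly (q i) (X i \<omega>) * exp (t * X i \<omega>) \<partial>M)"
        using int by (intro indep_vars_lebesgue_integral finite_I indep_compose) auto
      thus ?case
        by (simp only: prod.distrib S_def sum_distrib_left exp_sum[OF finite_I])
    qed
  qed
  ultimately have "(\<lambda>t. \<integral>\<omega>. (\<Prod>i\<in>I. poly (q i) (X i \<omega>)) * exp (t * S \<omega>) \<partial>M) has_fps_expansion
      (\<Prod>i\<in>I. moment_fps M (\<lambda>\<omega>. poly (q i) (X i \<omega>)) (X i))"
    by (subst (asm) has_fps_expansion_cong[OF _ refl])
  moreover have "(\<lambda>t. \<integral>\<omega>. (\<Prod>i\<in>I. poly (q i) (X i \<omega>)) * exp (t * S \<omega>) \<partial>M) has_fps_expansion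
      moment_fps M (\<lambda>\<omega>. \<Prod>i\<in>I. poly (q i) (X i \<omega>)) S"
    using \<delta>(3)[rule_format, of q] by (intro has_fps_expansion_moment_fps[OF _ _ \<delta>(1)]) auto
  ultimately have "moment_fps M (\<lambda>\<omega>. \<Prod>i\<in>I. poly (q i) (X i \<omega>)) S =
      (\<Prod>i\<in>I. moment_fps M (\<lambda>\<omega>. poly (q i) (X i \<omega>)) (X i))"
    using fps_expansion_unique by blast
  also have "\<dots> = (\<Prod>i\<in>I. moment_fps (law i) (poly (q i)) (\<lambda>x. x))"
    by (intro prod.cong refl) (simp add: law_def moment_fps_distr)
  finally show ?thesis .
qed

lemma mgf_fps_sum_law: "mgf_fps sum_law = (\<Prod>i\<in>I. mgf_fps (law i))"
proof -
  have "poly 1 = (\<lambda>_. 1 :: real)" by (simp add: fun_eq_iff)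
  thus ?thesis
    using moment_fps_prod[of "\<lambda>_. 1"] by (simp add: sum_law_def moment_fps_distr)
qed

section \<open>Polynomials, norms and parameters of the sum\<close>

text \<open>The exponential turns the sum of the arguments into a product, and the moment series of
  \<open>S\<close> is the product of those of the summands, so the generating functions multiply.
  The multinomial coefficient stems from the factorials in their normalisation.\<close>

lemma poly_Q_sum:
  "poly (Q m) (\<Sum>i\<in>I. x i) = (\<Sum>n | n \<in> I \<rightarrow>\<^sub>E (UNIV :: nat set) \<and> (\<Sum>i\<in>I. n i) = m.
     fact m / (\<Prod>i\<in>I. fact (n i)) * (\<Prod>i\<in>I. poly (P i (n i)) (x i)))"
proof -
  have exp: "fps_exp (\<Sum>i\<in>I. x i) = (\<Prod>i\<in>I. fps_exp (x i))"
    using finite_I by induction (simp_all add: fps_exp_add_mult)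
  have "Abs_fps (\<lambda>n. poly (Q n) (\<Sum>i\<in>I. x i) / fact n) =
      (\<Prod>i\<in>I. Abs_fps (\<lambda>n. poly (P i n) (x i) / fact n))"
    unfolding Q_def P_def law_poly_generating_function mgf_fps_sum_law exp
    by (simp add: fps_compose_prod_distrib[OF U0] inverse_prod_fps prod.distrib)
  hence "poly (Q m) (\<Sum>i\<in>I. x i) / fact m =
      (\<Sum>n | n \<in> I \<rightarrow>\<^sub>E (UNIV :: nat set) \<and> (\<Sum>i\<in>I. n i) = m. \<Prod>i\<in>I. poly (P i (n i)) (x i) / fact (n i))"
    using fps_prod_nth_PiE[OF finite_I, of "\<lambda>i. Abs_fps (\<lambda>n. poly (P i n) (x i) / fact n)" m]
    by (simp add: fps_eq_iff)
  thus ?thesis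
    by (simp add: prod_dividef field_simps sum_distrib_left)
qed

lemma integral_law_P_mult:
  assumes "i \<in> I"
  shows "(\<integral>x. poly (P i m) x * poly (P i n) x \<partial>law i) = (if m = n then H i n else 0)"
  using orthogonal_law_law[OF assms] by (simp add: orthogonal_law_def P_def H_def power2_eq_square)

lemma H_nonneg: "H i n \<ge> 0"
  unfolding H_def by simp

lemma finite_compositions:
  "finite {n. n \<in> I \<rightarrow>\<^sub>E (UNIV :: nat set) \<and> (\<Sum>i\<in>I. n i) = m}"
proof (rule finite_subset)
  show "{n. n \<in> I \<rightarrow>\<^sub>E (UNIV :: nat set) \<and> (\<Sum>i\<in>I. n i) = m} \<subseteq> I \<rightarrow>\<^sub>E {..m}"
  proof
    fix n assume n: "n \<in> {n. n \<in> I \<rightarrow>\<^sub>E (UNIV :: nat set) \<and> (\<Sum>i\<in>I. n i) = m}"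
    hence "n i \<le> m" if "i \<in> I" for i
      using member_le_sum[OF that, of n] finite_I by auto
    with n show "n \<in> I \<rightarrow>\<^sub>E {..m}" by (auto simp: PiE_def)
  qed
  show "finite (I \<rightarrow>\<^sub>E {..m})" using finite_I by (intro finite_PiE) auto
qed

text \<open>Both polynomials are expanded by the multinomial formula and independence factorises the
  expectations. For \<open>m \<noteq> k\<close> the result is orthogonality for the law of the sum;
  for \<open>m = k\<close> it exhibits \<open>K m\<close> as a sum of nonnegative terms, which
  \<open>norm_ratio\<close> uses.\<close>

lemma integral_sum_law_Q_mult:
  "(\<integral>x. poly (Q m) x * poly (Q k) x \<partial>sum_law) = (if m = k then
     (\<Sum>n | n \<in> I \<rightarrow>\<^sub>E (UNIV :: nat set) \<and> (\<Sum>i\<in>I. n i) = m.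
        (fact m / (\<Prod>i\<in>I. fact (n i)))\<^sup>2 * (\<Prod>i\<in>I. H i (n i))) else 0)"
proof -
  define N where "N m = {n. n \<in> I \<rightarrow>\<^sub>E (UNIV :: nat set) \<and> (\<Sum>i\<in>I. n i) = m}" for m
  define c :: "nat \<Rightarrow> ('i \<Rightarrow> nat) \<Rightarrow> real" where "c m n = fact m / (\<Prod>i\<in>I. fact (n i))" for m n
  have poly_mult_fun: "poly (p * q) = (\<lambda>x. poly p x * poly q x)" for p q :: "real poly"
    by (simp add: fun_eq_iff)
  have fin: "finite (N m)" for m
    unfolding N_def by (rule finite_compositions)
  have "(\<integral>x. poly (Q m) x * poly (Q k) x \<partial>sum_law) = (\<integral>\<omega>. poly (Q m) (S \<omega>) * poly (Q k) (S \<omega>) \<partial>M)"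
    by (simp add: sum_law_def integral_distr)
  also have "\<dots> = (\<integral>\<omega>. (\<Sum>n\<in>N m. \<Sum>n'\<in>N k. c m n * c k n' *
      (\<Prod>i\<in>I. poly (P i (n i) * P i (n' i)) (X i \<omega>))) \<partial>M)"
    unfolding S_def poly_Q_sum N_def[symmetric] c_def[symmetric] sum_product
    by (simp add: prod.distrib mult_ac)
  also have "\<dots> = (\<Sum>n\<in>N m. \<Sum>n'\<in>N k. c m n * c k n' *
      (\<integral>\<omega>. (\<Prod>i\<in>I. poly (P i (n i) * P i (n' i)) (X i \<omega>)) \<partial>M))"
    using integrable_prod by (simp del: poly_mult)
  also have "\<dots> = (\<Sum>n\<in>N m. \<Sum>n'\<in>N k. if n = n' then (c m n)\<^sup>2 * (\<Prod>i\<in>I. H i (n i)) else 0)"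
  proof (intro sum.cong refl)
    fix n n' assume n: "n \<in> N m" "n' \<in> N k"
    have "(\<integral>\<omega>. (\<Prod>i\<in>I. poly (P i (n i) * P i (n' i)) (X i \<omega>)) \<partial>M) =
        (\<Prod>i\<in>I. if n i = n' i then H i (n' i) else 0)"
      unfolding expectation_prod by (intro prod.cong refl) (simp add: poly_mult_fun integral_law_P_mult)
    moreover have "m = k" if "n = n'"
      using n that by (auto simp: N_def)
    \<comment> \<open>Distinct extensional tuples differ at some index in \<open>I\<close>, and the
      factor at that index is 0.\<close>
    moreover have "(\<Prod>i\<in>I. if n i = n' i then H i (n' i) else 0) = 0" if "n \<noteq> n'"
    proof -
      have "n \<in> I \<rightarrow>\<^sub>E UNIV" "n' \<in> I \<rightarrow>\<^sub>E UNIV"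
        using n by (simp_all add: N_def)
      with that obtain i where "i \<in> I" "n i \<noteq> n' i"
        using PiE_ext by metis
      thus ?thesis using finite_I by (intro prod_zero) auto
    qed
    ultimately show "c m n * c k n' * (\<integral>\<omega>. (\<Prod>i\<in>I. poly (P i (n i) * P i (n' i)) (X i \<omega>)) \<partial>M) =
        (if n = n' then (c m n)\<^sup>2 * (\<Prod>i\<in>I. H i (n i)) else 0)"
      by (cases "n = n'") (simp_all add: power2_eq_square)
  qed
  also have "\<dots> = (\<Sum>n\<in>N m. if n \<in> N k then (c m n)\<^sup>2 * (\<Prod>i\<in>I. H i (n i)) else 0)"
    using fin by (simp add: sum.delta)
  also have "\<dots> = (if m = k then (\<Sum>n\<in>N m. (c m n)\<^sup>2 * (\<Prod>i\<in>I. H i (n i))) else 0)"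
    by (auto simp: N_def intro!: sum.neutral)
  finally show ?thesis
    unfolding N_def c_def .
qed

lemma orthogonal_law_sum_law: "orthogonal_law sum_law"
  unfolding orthogonal_law_def
  using real_distribution_sum_law exp_moments_sum_law integral_sum_law_Q_mult by (simp add: Q_def)

text \<open>The linear factor in \<open>mgf_fps_deriv_compose\<close> acts as a logarithmic
  derivative and therefore adds up over products. Cancelling the nonzero moment series of the sum
  and comparing the two coefficients yields mean and variance at once.\<close>

lemma law_mean_variance_sum_law:
  "law_mean sum_law = (\<Sum>i\<in>I. law_mean (law i))"
  "law_variance sum_law = (\<Sum>i\<in>I. law_variance (law i))"
proof -
  define lin :: "real \<Rightarrow> real \<Rightarrow> real fps" where "lin a b = fps_const a + fps_const b * fps_X" for a b
  have nz: "mgf_fps sum_law oo U \<noteq> 0"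
    using mgf_fps_0[OF real_distribution_sum_law] by (metis fps_compose_nth_0 fps_zero_nth zero_neq_one)
  \<comment> \<open>Stated for all \<open>J \<subseteq> I\<close> to allow induction on the index
    set; the product rule adds the linear factors.\<close>
  have deriv: "fps_deriv (\<Prod>i\<in>J. mgf_fps (law i)) oo U =
      lin (\<Sum>i\<in>J. law_mean (law i)) (\<Sum>i\<in>J. law_variance (law i)) * ((\<Prod>i\<in>J. mgf_fps (law i)) oo U)"
    if "J \<subseteq> I" for J
    using finite_subset[OF that finite_I] that
  proof (induction J rule: finite_induct)
    case (insert j J)
    hence "fps_deriv (mgf_fps (law j)) oo U =
        lin (law_mean (law j)) (law_variance (law j)) * (mgf_fps (law j) oo U)"
      using mgf_fps_deriv_compose[OF orthogonal_law_law[of j]] by (simp add: lin_def)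
    moreover have "lin (a + b) (c + d) = lin a c + lin b d" for a b c d
      by (simp add: lin_def algebra_simps flip: fps_const_add)
    ultimately show ?case
      using insert by (simp add: fps_compose_add_distrib fps_compose_mult_distrib[OF U0] algebra_simps)
  qed (simp add: lin_def)
  have "lin (law_mean sum_law) (law_variance sum_law) * (mgf_fps sum_law oo U) =
      lin (\<Sum>i\<in>I. law_mean (law i)) (\<Sum>i\<in>I. law_variance (law i)) * (mgf_fps sum_law oo U)"
    using deriv[OF order_refl, folded mgf_fps_sum_law] mgf_fps_deriv_compose[OF orthogonal_law_sum_law]
    unfolding lin_def by (simp only:)
  hence eq: "lin (law_mean sum_law) (law_variance sum_law) =
      lin (\<Sum>i\<in>I. law_mean (law i)) (\<Sum>i\<in>I. law_variance (law i))"
    using nz by simp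
  have "fps_nth (lin a b) 0 = a" "fps_nth (lin a b) 1 = b" for a b
    by (simp_all add: lin_def)
  thus "law_mean sum_law = (\<Sum>i\<in>I. law_mean (law i))"
    "law_variance sum_law = (\<Sum>i\<in>I. law_variance (law i))"
    using eq by metis+
qed

lemma sum_law_in_meixner_class: "sum_law \<in> meixner_class u"
  using orthogonal_law_sum_law law_variance_pos finite_I nonempty_I
  by (simp add: meixner_class_iff law_mean_variance_sum_law sum_pos)

text \<open>If \<open>K m = 0\<close>, the quotient by \<open>K m\<close> is \<open>0\<close>; the right-hand side vanishes too, because a positive
  multiple of it is one of the nonnegative terms that sum to \<open>K m\<close>.\<close>

lemma norm_ratio:
  assumes "(\<Sum>i\<in>I. n i) = m"
  shows "fact m / (\<Prod>i\<in>I. fact (n i)) * ((\<Prod>i\<in>I. H i (n i)) / K m) * (K m / fact m) =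
    (\<Prod>i\<in>I. H i (n i) / fact (n i))"
proof (cases "K m = 0")
  case True
  let ?N = "{n. n \<in> I \<rightarrow>\<^sub>E (UNIV :: nat set) \<and> (\<Sum>i\<in>I. n i) = m}"
  have zero: "(\<Sum>n\<in>?N. (fact m / (\<Prod>i\<in>I. fact (n i)))\<^sup>2 * (\<Prod>i\<in>I. H i (n i))) = 0"
    using True integral_sum_law_Q_mult[of m m] by (simp add: K_def power2_eq_square)
  have mem: "restrict n I \<in> ?N"
    using assms by simp
  have "(fact m / (\<Prod>i\<in>I. fact (restrict n I i)))\<^sup>2 * (\<Prod>i\<in>I. H i (restrict n I i)) = (0::real)"
    by (rule sum_nonneg_0[OF finite_compositions _ zero mem])
      (intro mult_nonneg_nonneg prod_nonneg ballI H_nonneg zero_le_power2)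
  hence "(\<Prod>i\<in>I. H i (n i)) = 0"
    using finite_I by simp
  thus ?thesis by (simp add: prod_dividef)
next
  case False
  thus ?thesis by (simp add: prod_dividef)
qed

section \<open>Conditional expectation given the sum\<close>

text \<open>After composition with \<open>U\<close> each factor is a constant times a power of
  \<open>fps_X\<close> times its moment series. The powers multiply to \<open>fps_X ^ m\<close> and
  the series to that of the sum, \<open>norm_ratio\<close> matches the constants, and
  \<open>U\<close> is cancelled at the end.\<close>

lemma moment_fps_prod_P:
  assumes "(\<Sum>i\<in>I. n i) = m"
  shows "moment_fps M (\<lambda>\<omega>. \<Prod>i\<in>I. poly (P i (n i)) (X i \<omega>)) S =
    fps_const (fact m / (\<Prod>i\<in>I. fact (n i)) * ((\<Prod>i\<in>I. H i (n i)) / K m)) *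
      moment_fps M (\<lambda>\<omega>. poly (Q m) (S \<omega>)) S"
proof -
  define c where "c = fact m / (\<Prod>i\<in>I. fact (n i)) * ((\<Prod>i\<in>I. H i (n i)) / K m)"
  have prod_const: "(\<Prod>i\<in>I. fps_const (a i)) = fps_const (\<Prod>i\<in>I. a i)" for a :: "'i \<Rightarrow> real"
    using finite_I by induction simp_all
  have "moment_fps M (\<lambda>\<omega>. \<Prod>i\<in>I. poly (P i (n i)) (X i \<omega>)) S oo U =
      (\<Prod>i\<in>I. moment_fps (law i) (poly (P i (n i))) (\<lambda>x. x) oo U)"
    by (simp add: moment_fps_prod fps_compose_prod_distrib[OF U0])
  also have "\<dots> = (\<Prod>i\<in>I. fps_const (H i (n i) / fact (n i)) * fps_X ^ n i * (mgf_fps (law i) oo U))"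
    unfolding P_def H_def by (intro prod.cong refl moment_fps_law_poly orthogonal_law_law)
  also have "\<dots> = fps_const (\<Prod>i\<in>I. H i (n i) / fact (n i)) * fps_X ^ m * (mgf_fps sum_law oo U)"
    unfolding prod.distrib prod_const mgf_fps_sum_law fps_compose_prod_distrib[OF U0] assms[symmetric]
    by (simp add: power_sum)
  also have "\<dots> = fps_const c * (fps_const (K m / fact m) * fps_X ^ m * (mgf_fps sum_law oo U))"
    unfolding norm_ratio[OF assms, symmetric] c_def by (simp add: mult.assoc flip: fps_const_mult)
  also have "fps_const (K m / fact m) * fps_X ^ m * (mgf_fps sum_law oo U) =
      moment_fps sum_law (poly (Q m)) (\<lambda>x. x) oo U"
    unfolding K_def Q_def by (rule moment_fps_law_poly[OF orthogonal_law_sum_law, symmetric])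
  also have "moment_fps sum_law (poly (Q m)) (\<lambda>x. x) = moment_fps M (\<lambda>\<omega>. poly (Q m) (S \<omega>)) S"
    unfolding sum_law_def by (rule moment_fps_distr) auto
  also have "fps_const c * (moment_fps M (\<lambda>\<omega>. poly (Q m) (S \<omega>)) S oo U) =
      (fps_const c * moment_fps M (\<lambda>\<omega>. poly (Q m) (S \<omega>)) S) oo U"
    by (simp add: fps_compose_mult_distrib[OF U0])
  finally show ?thesis
    using fps_compose_inj_right[OF U0] U1 unfolding c_def by simp
qed

text \<open>The product minus the claimed multiple of \<open>Q m\<close> has integral 0 against
  every \<open>S ^ k\<close>, hence over every event that \<open>S\<close> lies in a given Borel
  set. These events make up the generated sigma-algebra, so the characterisation of conditional
  expectation applies.\<close>

lemma real_cond_exp_prod_P: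
  assumes "(\<Sum>i\<in>I. n i) = m"
  shows "AE \<omega> in M. real_cond_exp M (vimage_algebra (space M) S borel)
      (\<lambda>\<omega>. \<Prod>i\<in>I. poly (P i (n i)) (X i \<omega>)) \<omega> =
    fact m / (\<Prod>i\<in>I. fact (n i)) * ((\<Prod>i\<in>I. H i (n i)) / K m) * poly (Q m) (S \<omega>)"
proof -
  let ?F = "vimage_algebra (space M) S borel"
  define f where "f \<omega> = (\<Prod>i\<in>I. poly (P i (n i)) (X i \<omega>))" for \<omega>
  define c where "c = fact m / (\<Prod>i\<in>I. fact (n i)) * ((\<Prod>i\<in>I. H i (n i)) / K m)"
  define g where "g \<omega> = c * poly (Q m) (S \<omega>)" for \<omega>
  have [measurable]: "f \<in> borel_measurable M" "g \<in> borel_measurable M"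
    unfolding f_def g_def by measurable
  obtain \<delta> where \<delta>: "\<delta> > 0" "\<forall>i\<in>I. \<forall>q. integrable M (\<lambda>\<omega>. \<bar>poly q (X i \<omega>)\<bar> * exp (\<delta> * \<bar>X i \<omega>\<bar>))"
    "\<forall>q. integrable M (\<lambda>\<omega>. \<bar>\<Prod>i\<in>I. poly (q i) (X i \<omega>)\<bar> * exp (\<delta> * \<bar>S \<omega>\<bar>))"
    using exp_integrable_prod by blast
  have int1: "integrable M (\<lambda>\<omega>. \<bar>f \<omega>\<bar> * exp (\<delta> * \<bar>S \<omega>\<bar>))"
    using \<delta>(3) by (simp add: f_def)
  have int_exp: "integrable M (\<lambda>\<omega>. \<bar>1\<bar> * exp (\<delta> * \<bar>S \<omega>\<bar>))"
    using \<delta>(3)[rule_format, of "\<lambda>_. 1"] by simp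
  \<comment> \<open>Half of the rate is spent on the polynomial in \<open>S\<close>, so the bound
    for the difference \<open>f - g\<close> also has rate \<open>\<delta> / 2\<close>.\<close>
  have int2: "integrable M (\<lambda>\<omega>. \<bar>g \<omega>\<bar> * exp (\<delta> / 2 * \<bar>S \<omega>\<bar>))"
    using integrable_poly_exp[OF _ _ int_exp, of "\<delta> / 2" "Q m"] \<delta>(1)
    by (simp add: g_def abs_mult mult.assoc)
  have int: "integrable M (\<lambda>\<omega>. h \<omega> * S \<omega> ^ k)"
    if [measurable]: "h \<in> borel_measurable M" and "integrable M (\<lambda>\<omega>. \<bar>h \<omega>\<bar> * exp (\<epsilon> * \<bar>S \<omega>\<bar>))" "\<epsilon> > 0" for h \<epsilon> k
  proof (rule Bochner_Integration.integrable_bound)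
    show "integrable M (\<lambda>\<omega>. norm (h \<omega>) * \<bar>S \<omega>\<bar> ^ k * exp (0 * \<bar>S \<omega>\<bar>))"
      by (rule integrable_power_exp[where \<delta> = \<epsilon>]) (use that in auto)
  qed (auto simp: abs_mult power_abs)
  have int_fg: "integrable M (\<lambda>\<omega>. f \<omega> * S \<omega> ^ k)" "integrable M (\<lambda>\<omega>. g \<omega> * S \<omega> ^ k)" for k
    using int[OF _ int1] int[OF _ int2] \<delta>(1) by simp_all
  have moments: "(\<integral>\<omega>. (f \<omega> - g \<omega>) * S \<omega> ^ k \<partial>M) = 0" for k
  proof -
    have "(\<integral>\<omega>. f \<omega> * S \<omega> ^ k \<partial>M) / fact k = c * ((\<integral>\<omega>. poly (Q m) (S \<omega>) * S \<omega> ^ k \<partial>M) / fact k)"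
      using arg_cong[OF moment_fps_prod_P[OF assms, folded c_def], of "\<lambda>F. fps_nth F k"]
      by (simp add: moment_fps_def f_def)
    moreover have "(\<integral>\<omega>. g \<omega> * S \<omega> ^ k \<partial>M) = c * (\<integral>\<omega>. poly (Q m) (S \<omega>) * S \<omega> ^ k \<partial>M)"
      by (simp add: g_def mult.assoc)
    ultimately have "(\<integral>\<omega>. f \<omega> * S \<omega> ^ k \<partial>M) = (\<integral>\<omega>. g \<omega> * S \<omega> ^ k \<partial>M)"
      by simp
    thus ?thesis using int_fg[of k] by (simp add: left_diff_distrib)
  qed
  have int_diff: "integrable M (\<lambda>\<omega>. \<bar>f \<omega> - g \<omega>\<bar> * exp (\<delta> / 2 * \<bar>S \<omega>\<bar>))"
  proof (rule Bochner_Integration.integrable_bound)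
    show "integrable M (\<lambda>\<omega>. \<bar>f \<omega>\<bar> * exp (\<delta> * \<bar>S \<omega>\<bar>) + \<bar>g \<omega>\<bar> * exp (\<delta> / 2 * \<bar>S \<omega>\<bar>))"
      using int1 int2 by simp
    have "\<bar>f \<omega> - g \<omega>\<bar> * exp (\<delta> / 2 * \<bar>S \<omega>\<bar>) \<le> \<bar>f \<omega>\<bar> * exp (\<delta> * \<bar>S \<omega>\<bar>) + \<bar>g \<omega>\<bar> * exp (\<delta> / 2 * \<bar>S \<omega>\<bar>)" for \<omega>
    proof -
      have "\<bar>f \<omega> - g \<omega>\<bar> * exp (\<delta> / 2 * \<bar>S \<omega>\<bar>) \<le> (\<bar>f \<omega>\<bar> + \<bar>g \<omega>\<bar>) * exp (\<delta> / 2 * \<bar>S \<omega>\<bar>)"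
        by (intro mult_right_mono) auto
      moreover have "\<bar>f \<omega>\<bar> * exp (\<delta> / 2 * \<bar>S \<omega>\<bar>) \<le> \<bar>f \<omega>\<bar> * exp (\<delta> * \<bar>S \<omega>\<bar>)"
        using \<delta>(1) by (intro mult_left_mono) (auto intro!: mult_right_mono)
      ultimately show ?thesis by (simp only: distrib_right)
    qed
    thus "AE \<omega> in M. norm (\<bar>f \<omega> - g \<omega>\<bar> * exp (\<delta> / 2 * \<bar>S \<omega>\<bar>)) \<le>
        norm (\<bar>f \<omega>\<bar> * exp (\<delta> * \<bar>S \<omega>\<bar>) + \<bar>g \<omega>\<bar> * exp (\<delta> / 2 * \<bar>S \<omega>\<bar>))"
      by (intro always_eventually allI) (simp add: abs_of_nonneg)
  qed measurable
  have "subalgebra M ?F"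
    by (auto simp: subalgebra_def sets_vimage_algebra2 measurable_sets[OF S_measurable])
  then interpret finite_measure_subalgebra M ?F
    by unfold_locales
  have "AE \<omega> in M. real_cond_exp M ?F f \<omega> = g \<omega>"
  proof (rule real_cond_exp_charact)
    show int_f: "integrable M f" and int_g: "integrable M g"
      using int_fg[of 0] by simp_all
    have "S \<in> borel_measurable ?F"
      by (rule measurable_vimage_algebra1) auto
    thus "g \<in> borel_measurable ?F"
      unfolding g_def by measurable
    fix A assume "A \<in> sets ?F"
    then obtain B where B: "B \<in> sets borel" "A = S -` B \<inter> space M"
      by (auto simp: sets_vimage_algebra2)
    have A: "A \<in> sets M"
      unfolding B(2) using B(1) by measurable
    have "(\<integral>\<omega>. (f \<omega> - g \<omega>) * indicator B (S \<omega>) \<partial>M) = 0"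
      by (rule integral_vimage_eq_0_if_moments_eq_0[OF _ _ _ int_diff]) (use moments B(1) \<delta>(1) in auto)
    also have "(\<integral>\<omega>. (f \<omega> - g \<omega>) * indicator B (S \<omega>) \<partial>M) =
        (\<integral>\<omega>. indicator A \<omega> *\<^sub>R f \<omega> - indicator A \<omega> *\<^sub>R g \<omega> \<partial>M)"
      by (intro Bochner_Integration.integral_cong refl) (auto simp: B(2) indicator_def)
    also have "\<dots> = (\<integral>\<omega>\<in>A. f \<omega> \<partial>M) - (\<integral>\<omega>\<in>A. g \<omega> \<partial>M)"
      unfolding set_lebesgue_integral_def
      by (intro Bochner_Integration.integral_diff integrable_mult_indicator A int_f int_g)
    finally show "(\<integral>\<omega>\<in>A. f \<omega> \<partial>M) = (\<integral>\<omega>\<in>A. g \<omega> \<partial>M)"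
      by simp
  qed
  thus ?thesis
    unfolding f_def g_def c_def .
qed

end

section \<open>Transfer to laws, polynomials and norms indexed by parameters\<close>

theorem proposition2:
  fixes u :: "real \<Rightarrow> real"
    and d :: nat
    and r :: "nat \<Rightarrow> real \<times> real"
    and M :: "'a measure"
    and X :: "nat \<Rightarrow> 'a \<Rightarrow> real"
  assumes u_series: "\<exists>F. u has_fps_expansion F"
    and u_0: "u 0 = 0"
    and u_deriv: "(u has_real_derivative 1) (at 0)"
    and d: "d \<ge> 1"
    and M: "prob_space M"
    and indep: "prob_space.indep_vars M (\<lambda>_. borel) X {1..d}"
    and law: "\<And>i. i \<in> {1..d} \<Longrightarrow> distr M borel (X i) \<in> meixner_class u"
    and params: "\<And>i. i \<in> {1..d} \<Longrightarrow>
       r i = (law_mean (distr M borel (X i)), law_variance (distr M borel (X i)))"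
  shows "(\<forall>(m::nat) (x :: nat \<Rightarrow> real).
            poly (meixner_poly u (\<Sum>i=1..d. r i) m) (\<Sum>i=1..d. x i) =
            (\<Sum>n | n \<in> {1..d} \<rightarrow>\<^sub>E (UNIV :: nat set) \<and> (\<Sum>i=1..d. n i) = m.
               multinomial_coeff d n * (\<Prod>i=1..d. poly (meixner_poly u (r i) (n i)) (x i)))) \<and>
         (\<forall>n :: nat \<Rightarrow> nat. AE \<omega> in M.
            real_cond_exp M (vimage_algebra (space M) (\<lambda>\<omega>. \<Sum>i=1..d. X i \<omega>) borel)
              (\<lambda>\<omega>. \<Prod>i=1..d. poly (meixner_poly u (r i) (n i)) (X i \<omega>)) \<omega> =
            multinomial_coeff d n *
              ((\<Prod>i=1..d. meixner_norm2 u (r i) (n i)) /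
               meixner_norm2 u (\<Sum>i=1..d. r i) (\<Sum>i=1..d. n i)) *
              poly (meixner_poly u (\<Sum>i=1..d. r i) (\<Sum>i=1..d. n i)) (\<Sum>i=1..d. X i \<omega>))"
proof -
  interpret prob_space M by fact
  from u_series obtain U where U: "u has_fps_expansion U" ..
  have "fps_nth U 0 = 0"
    using has_fps_expansion_imp_0_eq_fps_nth_0[OF U] u_0 by simp
  moreover have "fps_nth U 1 = 1"
    by (rule has_fps_expansion_imp_fps_nth_1[OF U u_deriv])
  ultimately interpret family: independent_meixner u U M "{1..d}" X
    by unfold_locales (use U d indep law in auto)
  have r: "r i = (law_mean (family.law i), law_variance (family.law i))" if "i \<in> {1..d}" for i
    using params[OF that] by (simp add: family.law_def)
  have fst_snd: "fst (\<Sum>i\<in>J. r i) = (\<Sum>i\<in>J. fst (r i))" "snd (\<Sum>i\<in>J. r i) = (\<Sum>i\<in>J. snd (r i))" for J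
    by (induction J rule: infinite_finite_induct) auto
  \<comment> \<open>The summed parameters are the mean and variance of the law of the sum, so the
    objects indexed by them are those of \<open>sum_law\<close>.\<close>
  have r_sum: "(\<Sum>i=1..d. r i) = (law_mean family.sum_law, law_variance family.sum_law)"
  proof (rule prod_eqI)
    show "fst (\<Sum>i=1..d. r i) = fst (law_mean family.sum_law, law_variance family.sum_law)"
      unfolding fst_snd fst_conv family.law_mean_variance_sum_law by (intro sum.cong refl) (simp add: r)
    show "snd (\<Sum>i=1..d. r i) = snd (law_mean family.sum_law, law_variance family.sum_law)"
      unfolding fst_snd snd_conv family.law_mean_variance_sum_law by (intro sum.cong refl) (simp add: r)
  qed
  \<comment> \<open>Here the definite descriptions behind the parametrised notions give way to the
    explicit polynomials and norms.\<close>
  have polys: "meixner_poly u (r i) = family.P i" "meixner_norm2 u (r i) = family.H i" if "i \<in> {1..d}" for i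
    using family.meixner_poly_eq[OF law[OF that]] family.meixner_law_eq[OF law[OF that]] params[OF that]
    by (simp_all add: meixner_norm2_def[abs_def] family.P_def family.H_def[abs_def] family.law_def)
  have sum_polys: "meixner_poly u (\<Sum>i=1..d. r i) = family.Q" "meixner_norm2 u (\<Sum>i=1..d. r i) = family.K"
    using family.meixner_poly_eq[OF family.sum_law_in_meixner_class]
      family.meixner_law_eq[OF family.sum_law_in_meixner_class]
    unfolding r_sum meixner_norm2_def[abs_def] family.Q_def family.K_def[abs_def] by (simp_all only:)
  show ?thesis
  proof (intro conjI allI)
    fix m and x :: "nat \<Rightarrow> real"
    show "poly (meixner_poly u (\<Sum>i=1..d. r i) m) (\<Sum>i=1..d. x i) =
            (\<Sum>n | n \<in> {1..d} \<rightarrow>\<^sub>E (UNIV :: nat set) \<and> (\<Sum>i=1..d. n i) = m.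
               multinomial_coeff d n * (\<Prod>i=1..d. poly (meixner_poly u (r i) (n i)) (x i)))"
      unfolding sum_polys family.poly_Q_sum
      by (intro sum.cong refl) (auto simp: multinomial_coeff_def polys)
  next
    fix n :: "nat \<Rightarrow> nat"
    have "(\<Prod>i=1..d. poly (meixner_poly u (r i) (n i)) (X i \<omega>)) =
        (\<Prod>i=1..d. poly (family.P i (n i)) (X i \<omega>))" for \<omega>
      by (intro prod.cong refl) (simp add: polys)
    moreover have "(\<Prod>i=1..d. meixner_norm2 u (r i) (n i)) = (\<Prod>i=1..d. family.H i (n i))"
      by (intro prod.cong refl) (simp add: polys)
    moreover have "(\<lambda>\<omega>. \<Sum>i=1..d. X i \<omega>) = family.S"
      by (simp only: family.S_def[abs_def])
    ultimately show "AE \<omega> in M.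
            real_cond_exp M (vimage_algebra (space M) (\<lambda>\<omega>. \<Sum>i=1..d. X i \<omega>) borel)
              (\<lambda>\<omega>. \<Prod>i=1..d. poly (meixner_poly u (r i) (n i)) (X i \<omega>)) \<omega> =
            multinomial_coeff d n *
              ((\<Prod>i=1..d. meixner_norm2 u (r i) (n i)) /
               meixner_norm2 u (\<Sum>i=1..d. r i) (\<Sum>i=1..d. n i)) *
              poly (meixner_poly u (\<Sum>i=1..d. r i) (\<Sum>i=1..d. n i)) (\<Sum>i=1..d. X i \<omega>)"
      using family.real_cond_exp_prod_P[of n "\<Sum>i=1..d. n i"]
      unfolding sum_polys multinomial_coeff_def family.S_def[symmetric] by simp
  qed
qed

end
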